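(* Assume $\diamondsuit^+$. There is a map $X\mapsto T^X$ from subsets of $\omega_1$ to downward closed $\aleph_1$-subtrees of $2^{<\omega_1}$ such that (1) if $X\cap\alpha=Y\cap\alpha$ then $T^X\upharpoonright\alpha=T^Y\upharpoonright\alpha$; (2) if $X$ is stationary then $T^X$ is a Suslin tree; (3) if $X$ is non-stationary then $T^X$ is a special Aronszajn tree.
   Context: $2^{<\omega_1}$ is the set of binary sequences of countable length, ordered by end-extension; a subtree $T\subseteq 2^{<\omega_1}$ is downward closed if closed under initial segments, and an $\aleph_1$-subtree if each level $T_\xi$ ($\xi<\omega_1$) is countable and nonempty. $T\upharpoonright\alpha$ denotes the set of nodes of $T$ of height less than $\alpha$. An Aronszajn tree is an $\aleph_1$-tree without uncountable branches; a Suslin tree is an Aronszajn tree without uncountable antichains; a special Aronszajn tree is an Aronszajn tree which is a union of countably many antichains. $\diamondsuit^+$ asserts the existence of a sequence $(\mathcal A_\alpha)_{\alpha<\omega_1}$ of countable sets such that for every $X\subseteq\omega_1$ there is a club $C\subseteq\omega_1$ with $C\cap\alpha, X\cap\alpha\in\mathcal A_\alpha$ for all $\alpha\in C$. *)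

theory Defs
  imports Main "HOL-Library.Countable_Set"
begin

section \<open>The first uncountable ordinal\<close>

text \<open>The elements of \<open>omega1\<close> are the countable ordinals; the ordinal \<open>\<alpha> < \<omega>\<^sub>1\<close>, as a set,
  is \<open>{..<\<alpha>}\<close>.\<close>

typedef omega1 = "Field (cardSuc natLeq)"
proof -
  have "infinite (Field (cardSuc natLeq))"
    using cardSuc_finite[OF natLeq_Card_order] by (simp add: Field_natLeq)
  then show ?thesis using infinite_imp_nonempty by blast
qed

lemma Well_order_cardSuc_natLeq: "Well_order (cardSuc natLeq)"
  by (rule card_order_on_well_order_on[OF cardSuc_Card_order[OF natLeq_Card_order]])

instantiation omega1 :: wellorder
begin

definition less_eq_omega1 :: "omega1 \<Rightarrow> omega1 \<Rightarrow> bool"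
  where "x \<le> y \<longleftrightarrow> (Rep_omega1 x, Rep_omega1 y) \<in> cardSuc natLeq"

definition less_omega1 :: "omega1 \<Rightarrow> omega1 \<Rightarrow> bool"
  where "(x::omega1) < y \<longleftrightarrow> x \<le> y \<and> x \<noteq> y"

instance
proof
  let ?r = "cardSuc natLeq"
  have lin: "Linear_order ?r" and wf: "wf (?r - Id)"
    using Well_order_cardSuc_natLeq by (simp_all add: well_order_on_def)
  have refl: "refl_on (Field ?r) ?r" and trans: "trans ?r" and antisym: "antisym ?r"
    and total: "total_on (Field ?r) ?r"
    using lin by (simp_all add: linear_order_on_def partial_order_on_def preorder_on_def)
  fix x y z :: omega1
  show le_refl: "x \<le> x"
    unfolding less_eq_omega1_def using refl Rep_omega1 by (rule refl_onD)
  show "x \<le> y \<Longrightarrow> y \<le> z \<Longrightarrow> x \<le> z"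
    unfolding less_eq_omega1_def using trans by (rule transD)
  show anti: "x \<le> y \<Longrightarrow> y \<le> x \<Longrightarrow> x = y"
    unfolding less_eq_omega1_def using antisymD[OF antisym] by (simp add: Rep_omega1_inject[symmetric])
  show "x < y \<longleftrightarrow> x \<le> y \<and> \<not> y \<le> x"
    unfolding less_omega1_def using anti le_refl by blast
  show "x \<le> y \<or> y \<le> x"
    using total le_refl Rep_omega1[of x] Rep_omega1[of y]
    unfolding less_eq_omega1_def
    by (cases "x = y") (simp_all add: total_on_def less_eq_omega1_def Rep_omega1_inject)
  fix P :: "omega1 \<Rightarrow> bool" and a
  assume step: "\<And>x. (\<And>y. y < x \<Longrightarrow> P y) \<Longrightarrow> P x"
  have wf': "wf (inv_image (?r - Id) Rep_omega1)"
    using wf by (rule wf_inv_image)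
  show "P a"
    using wf'
  proof (induction a rule: wf_induct_rule)
    case (less x)
    show ?case
    proof (rule step)
      fix y assume "y < x"
      then have "(y, x) \<in> inv_image (?r - Id) Rep_omega1"
        by (simp add: less_omega1_def less_eq_omega1_def Rep_omega1_inject)
      then show "P y" by (rule less)
    qed
  qed
qed

end

lemma uncountable_omega1: "uncountable (UNIV :: omega1 set)"
proof
  assume "countable (UNIV :: omega1 set)"
  then have "countable (range Rep_omega1)" by (rule countable_image)
  then have "countable (Field (cardSuc natLeq))"
    using type_definition.Rep_range[OF type_definition_omega1] by simp
  then obtain f :: "nat set \<Rightarrow> nat" where "inj_on f (Field (cardSuc natLeq))"
    by (auto simp: countable_def)
  then have "ordLeq3 (card_of (Field (cardSuc natLeq))) (card_of (UNIV :: nat set))"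
    unfolding card_of_ordLeq[symmetric] by blast
  moreover have "ordIso2 (card_of (Field (cardSuc natLeq))) (cardSuc natLeq)"
    by (rule card_of_Field_ordIso[OF cardSuc_Card_order[OF natLeq_Card_order]])
  moreover have "ordIso2 (card_of (UNIV :: nat set)) natLeq"
    by (rule card_of_nat)
  ultimately have "ordLeq3 (cardSuc natLeq) natLeq"
    using ordIso_ordLeq_trans[OF ordIso_symmetric] ordLeq_ordIso_trans by metis
  then show False
    using not_ordLess_ordLeq[OF cardSuc_greater[OF natLeq_Card_order]] by simp
qed

lemma countable_lessThan_omega1: "countable {..<\<alpha> :: omega1}"
proof -
  let ?r = "cardSuc natLeq" and ?a = "Rep_omega1 \<alpha>"
  have "ordLess2 (card_of (underS ?r ?a)) ?r"
    using card_of_underS[OF cardSuc_Card_order[OF natLeq_Card_order] Rep_omega1] .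
  then have "ordLeq3 (card_of (underS ?r ?a)) natLeq"
    unfolding cardSuc_ordLeq_ordLess[OF natLeq_Card_order card_of_Card_order] .
  then have "ordLeq3 (card_of (underS ?r ?a)) (card_of (UNIV :: nat set))"
    by (rule ordLeq_ordIso_trans) (rule ordIso_symmetric[OF card_of_nat])
  then obtain g :: "nat set \<Rightarrow> nat" where "inj_on g (underS ?r ?a)"
    unfolding card_of_ordLeq[symmetric] by blast
  then have "countable (underS ?r ?a)" by (auto simp: countable_def)
  moreover have "Rep_omega1 ` {..<\<alpha>} \<subseteq> underS ?r ?a"
    by (auto simp: underS_def less_omega1_def less_eq_omega1_def Rep_omega1_inject)
  ultimately have "countable (Rep_omega1 ` {..<\<alpha>})"
    using countable_subset by blast
  then show ?thesis
    by (rule countable_image_inj_on) (simp add: inj_on_def Rep_omega1_inject)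
qed


section \<open>Clubs, stationary sets and diamond plus\<close>

definition unbounded :: "omega1 set \<Rightarrow> bool"
  where "unbounded C \<longleftrightarrow> (\<forall>\<alpha>. \<exists>\<beta>\<in>C. \<alpha> < \<beta>)"

text \<open>The two premises make \<open>\<alpha>\<close> a limit ordinal with \<open>C \<inter> \<alpha>\<close> unbounded in \<open>\<alpha>\<close>.\<close>

definition order_closed :: "omega1 set \<Rightarrow> bool"
  where "order_closed C \<longleftrightarrow>
    (\<forall>\<alpha>. {..<\<alpha>} \<noteq> {} \<longrightarrow> (\<forall>\<beta><\<alpha>. \<exists>\<gamma>\<in>C. \<beta> < \<gamma> \<and> \<gamma> < \<alpha>) \<longrightarrow> \<alpha> \<in> C)"

definition club :: "omega1 set \<Rightarrow> bool"
  where "club C \<longleftrightarrow> order_closed C \<and> unbounded C"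

definition stationary :: "omega1 set \<Rightarrow> bool"
  where "stationary S \<longleftrightarrow> (\<forall>C. club C \<longrightarrow> S \<inter> C \<noteq> {})"

definition diamond_plus :: bool
  where "diamond_plus \<longleftrightarrow>
    (\<exists>\<A> :: omega1 \<Rightarrow> omega1 set set.
      (\<forall>\<alpha>. countable (\<A> \<alpha>)) \<and>
      (\<forall>X. \<exists>C. club C \<and> (\<forall>\<alpha>\<in>C. C \<inter> {..<\<alpha>} \<in> \<A> \<alpha> \<and> X \<inter> {..<\<alpha>} \<in> \<A> \<alpha>)))"


section \<open>Subtrees of the tree of countable binary sequences\<close>

text \<open>A binary sequence of length \<open>\<alpha>\<close> is a partial function with domain \<open>{..<\<alpha>}\<close>;
  end-extension is then \<open>(\<subseteq>\<^sub>m)\<close>.\<close>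

type_synonym binseq = "omega1 \<rightharpoonup> bool"

definition binseqs :: "binseq set"
  where "binseqs = {s. \<exists>\<alpha>. dom s = {..<\<alpha>}}"

definition subtree :: "binseq set \<Rightarrow> bool"
  where "subtree T \<longleftrightarrow> T \<subseteq> binseqs"

definition downward_closed :: "binseq set \<Rightarrow> bool"
  where "downward_closed T \<longleftrightarrow> (\<forall>t\<in>T. \<forall>s\<in>binseqs. s \<subseteq>\<^sub>m t \<longrightarrow> s \<in> T)"

definition predecessors :: "binseq set \<Rightarrow> binseq \<Rightarrow> binseq set"
  where "predecessors T t = {s \<in> T. s \<subseteq>\<^sub>m t \<and> s \<noteq> t}"

text \<open>The height of \<open>t\<close> in \<open>T\<close> is the order type of its set of predecessors.\<close>

definition has_height :: "binseq set \<Rightarrow> binseq \<Rightarrow> omega1 \<Rightarrow> bool"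
  where "has_height T t \<xi> \<longleftrightarrow>
    (\<exists>f. bij_betw f {..<\<xi>} (predecessors T t) \<and>
         (\<forall>\<beta><\<xi>. \<forall>\<gamma><\<xi>. \<beta> \<le> \<gamma> \<longleftrightarrow> f \<beta> \<subseteq>\<^sub>m f \<gamma>))"

definition level :: "binseq set \<Rightarrow> omega1 \<Rightarrow> binseq set"
  where "level T \<xi> = {t \<in> T. has_height T t \<xi>}"

definition tree_restrict :: "binseq set \<Rightarrow> omega1 \<Rightarrow> binseq set"
  where "tree_restrict T \<alpha> = {t \<in> T. \<exists>\<xi><\<alpha>. has_height T t \<xi>}"

definition aleph1_subtree :: "binseq set \<Rightarrow> bool"
  where "aleph1_subtree T \<longleftrightarrow>
    subtree T \<and> (\<forall>\<xi>. countable (level T \<xi>) \<and> level T \<xi> \<noteq> {})"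

abbreviation branch :: "binseq set \<Rightarrow> binseq set \<Rightarrow> bool"
  where "branch T B \<equiv> pred_on.maxchain T (\<subseteq>\<^sub>m) B"

definition antichain :: "binseq set \<Rightarrow> binseq set \<Rightarrow> bool"
  where "antichain T A \<longleftrightarrow> A \<subseteq> T \<and> (\<forall>s\<in>A. \<forall>t\<in>A. s \<noteq> t \<longrightarrow> \<not> s \<subseteq>\<^sub>m t \<and> \<not> t \<subseteq>\<^sub>m s)"

definition aronszajn_tree :: "binseq set \<Rightarrow> bool"
  where "aronszajn_tree T \<longleftrightarrow> aleph1_subtree T \<and> \<not> (\<exists>B. branch T B \<and> uncountable B)"

definition suslin_tree :: "binseq set \<Rightarrow> bool"
  where "suslin_tree T \<longleftrightarrow> aronszajn_tree T \<and> \<not> (\<exists>A. antichain T A \<and> uncountable A)"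

definition special_aronszajn_tree :: "binseq set \<Rightarrow> bool"
  where "special_aronszajn_tree T \<longleftrightarrow>
    aronszajn_tree T \<and> (\<exists>\<F>. countable \<F> \<and> (\<forall>A\<in>\<F>. antichain T A) \<and> T = \<Union>\<F>)"


section \<open>In downward closed subtrees, height is length\<close>

lemma order_iso_lessThan_le:
  fixes g :: "omega1 \<Rightarrow> omega1"
  assumes bij: "bij_betw g {..<\<xi>} {..<\<eta>}"
    and ord: "\<And>\<beta> \<gamma>. \<beta> < \<xi> \<Longrightarrow> \<gamma> < \<xi> \<Longrightarrow> \<beta> \<le> \<gamma> \<longleftrightarrow> g \<beta> \<le> g \<gamma>"
  shows "\<xi> \<le> \<eta>"
proof (rule ccontr)
  have ge: "\<beta> < \<xi> \<Longrightarrow> \<beta> \<le> g \<beta>" for \<beta>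
  proof (induction \<beta> rule: less_induct)
    case (less \<beta>)
    show ?case
    proof (rule ccontr)
      assume *: "\<not> \<beta> \<le> g \<beta>"
      then have "g \<beta> < \<xi>" using less.prems by auto
      then have "g \<beta> \<le> g (g \<beta>)" using less.IH * by auto
      then show False using ord[of \<beta> "g \<beta>"] * \<open>g \<beta> < \<xi>\<close> less.prems by auto
    qed
  qed
  assume "\<not> \<xi> \<le> \<eta>"
  then have "\<eta> < \<xi>" by auto
  then have "g \<eta> < \<eta>" using bij by (auto simp: bij_betw_def)
  then show False using ge[OF \<open>\<eta> < \<xi>\<close>] by auto
qed

lemma has_height_iff_dom:
  assumes T: "subtree T" "downward_closed T" and t: "t \<in> T"
  shows "has_height T t \<xi> \<longleftrightarrow> dom t = {..<\<xi>}"
proof -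
  obtain \<eta> where \<eta>: "dom t = {..<\<eta>}"
    using T t by (auto simp: subtree_def binseqs_def)
  define h where "h = (\<lambda>\<beta>. t |` {..<\<beta>})"
  have dom_h: "dom (h \<beta>) = {..<\<beta>}" if "\<beta> \<le> \<eta>" for \<beta>
    using that \<eta> by (auto simp: h_def)
  have h_le: "\<beta> \<le> \<gamma> \<longleftrightarrow> h \<beta> \<subseteq>\<^sub>m h \<gamma>" if "\<beta> < \<eta>" "\<gamma> < \<eta>" for \<beta> \<gamma>
  proof
    show "h \<beta> \<subseteq>\<^sub>m h \<gamma>" if "\<beta> \<le> \<gamma>"
      using that by (auto simp: h_def map_le_def restrict_map_def split: if_splits)
    assume "h \<beta> \<subseteq>\<^sub>m h \<gamma>"
    then have "dom (h \<beta>) \<subseteq> dom (h \<gamma>)" by (rule map_le_implies_dom_le)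
    then show "\<beta> \<le> \<gamma>" using dom_h that by auto
  qed
  have img: "h ` {..<\<eta>} = predecessors T t"
  proof (intro equalityI subsetI)
    fix s assume "s \<in> h ` {..<\<eta>}"
    then obtain \<beta> where \<beta>: "\<beta> < \<eta>" "s = h \<beta>" by auto
    have "s \<in> binseqs" using \<beta> dom_h by (auto simp: binseqs_def)
    moreover have "s \<subseteq>\<^sub>m t" by (auto simp: \<beta> h_def map_le_def restrict_map_def split: if_splits)
    moreover have "s \<noteq> t"
      using \<beta> dom_h[of \<beta>] \<eta> by (metis less_imp_le lessThan_eq_iff less_irrefl)
    ultimately show "s \<in> predecessors T t"
      using T t by (auto simp: predecessors_def downward_closed_def)
  next
    fix s assume s: "s \<in> predecessors T t"
    then have "s \<in> T" "s \<subseteq>\<^sub>m t" "s \<noteq> t" by (auto simp: predecessors_def)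
    then obtain \<beta> where \<beta>: "dom s = {..<\<beta>}"
      using T by (auto simp: subtree_def binseqs_def)
    have s_eq: "s = h \<beta>"
    proof
      fix x
      show "s x = h \<beta> x"
      proof (cases "x < \<beta>")
        case True
        then have "x \<in> dom s" using \<beta> by auto
        then show ?thesis using True \<open>s \<subseteq>\<^sub>m t\<close> by (simp add: map_le_def h_def)
      next
        case False
        then have "x \<notin> dom s" using \<beta> by auto
        then show ?thesis using False by (auto simp: h_def domIff)
      qed
    qed
    have "{..<\<beta>} \<subseteq> {..<\<eta>}" using \<open>s \<subseteq>\<^sub>m t\<close> \<beta> \<eta> map_le_implies_dom_le by metis
    moreover have "\<beta> \<noteq> \<eta>"
    proof
      assume "\<beta> = \<eta>"
      then have "h \<beta> = t"
        using map_le_antisym[of "h \<beta>" t] dom_h[of \<beta>] \<eta> by (auto simp: h_def map_le_def)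
      then show False using s_eq \<open>s \<noteq> t\<close> by simp
    qed
    ultimately have "\<beta> < \<eta>" by auto
    then show "s \<in> h ` {..<\<eta>}" using s_eq by auto
  qed
  have inj: "inj_on h {..<\<eta>}"
  proof (rule inj_onI)
    fix \<beta> \<gamma> assume *: "\<beta> \<in> {..<\<eta>}" "\<gamma> \<in> {..<\<eta>}" "h \<beta> = h \<gamma>"
    then have "\<beta> \<le> \<gamma>" "\<gamma> \<le> \<beta>" using h_le[of \<beta> \<gamma>] h_le[of \<gamma> \<beta>] by auto
    then show "\<beta> = \<gamma>" by auto
  qed
  have bij: "bij_betw h {..<\<eta>} (predecessors T t)"
    using inj img by (simp add: bij_betw_def)
  have unique: "\<xi> = \<eta>" if hh: "has_height T t \<xi>"
  proof -
    obtain f where f: "bij_betw f {..<\<xi>} (predecessors T t)"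
      and f_le: "\<And>\<beta> \<gamma>. \<beta> < \<xi> \<Longrightarrow> \<gamma> < \<xi> \<Longrightarrow> \<beta> \<le> \<gamma> \<longleftrightarrow> f \<beta> \<subseteq>\<^sub>m f \<gamma>"
      using hh unfolding has_height_def by blast
    define k where "k = inv_into {..<\<eta>} h"
    have k: "bij_betw k (predecessors T t) {..<\<eta>}"
      unfolding k_def using bij by (rule bij_betw_inv_into)
    have hk: "h (k s) = s" if "s \<in> predecessors T t" for s
      unfolding k_def using bij that by (simp add: bij_betw_inv_into_right)
    have kf: "bij_betw (k \<circ> f) {..<\<xi>} {..<\<eta>}" using f k by (rule bij_betw_trans)
    have kf_le: "\<beta> \<le> \<gamma> \<longleftrightarrow> (k \<circ> f) \<beta> \<le> (k \<circ> f) \<gamma>" if "\<beta> < \<xi>" "\<gamma> < \<xi>" for \<beta> \<gamma>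
    proof -
      have P: "f \<beta> \<in> predecessors T t" "f \<gamma> \<in> predecessors T t"
        using f that by (auto simp: bij_betw_def)
      then have "k (f \<beta>) < \<eta>" "k (f \<gamma>) < \<eta>" using k by (auto simp: bij_betw_def)
      then show ?thesis using h_le[of "k (f \<beta>)" "k (f \<gamma>)"] hk P f_le that by simp
    qed
    have le1: "\<xi> \<le> \<eta>" using kf kf_le by (rule order_iso_lessThan_le)
    define m where "m = inv_into {..<\<xi>} (k \<circ> f)"
    have m: "bij_betw m {..<\<eta>} {..<\<xi>}"
      unfolding m_def using kf by (rule bij_betw_inv_into)
    have km: "(k \<circ> f) (m \<beta>) = \<beta>" if "\<beta> < \<eta>" for \<beta>
      unfolding m_def by (rule bij_betw_inv_into_right[OF kf]) (use that in simp)
    have "\<beta> \<le> \<gamma> \<longleftrightarrow> m \<beta> \<le> m \<gamma>" if "\<beta> < \<eta>" "\<gamma> < \<eta>" for \<beta> \<gamma>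
    proof -
      have "m \<beta> < \<xi>" "m \<gamma> < \<xi>" using m that by (auto simp: bij_betw_def)
      then show ?thesis using kf_le[of "m \<beta>" "m \<gamma>"] km that by simp
    qed
    then have "\<eta> \<le> \<xi>" using order_iso_lessThan_le[OF m] by blast
    with le1 show ?thesis by auto
  qed
  have "has_height T t \<eta>"
    unfolding has_height_def by (rule exI[of _ h]) (use bij h_le in simp)
  then have "has_height T t \<xi> \<longleftrightarrow> \<xi> = \<eta>"
    using unique by metis
  then show ?thesis
    unfolding \<eta> lessThan_eq_iff by metis
qed

end

theory Submission
  imports Defs
begin

text \<open>
  Call a set \<open>d\<close> of limit ordinals good for \<open>X\<close> if it is closed, disjoint from \<open>X\<close>, and
  \<open>d \<inter> \<delta>\<close> is guessed at every \<open>\<delta> \<in> d\<close>. The tree is built level by level, with all one-bit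
  extensions at successors. At a limit \<open>\<alpha> \<in> X\<close> the cofinal branches that are continued decide every
  guessed subset of \<open>T \<restriction> \<alpha>\<close>, as in Jensen's construction of a Suslin tree. At a limit
  \<open>\<alpha> \<notin> X\<close> the branches \<open>t\<close> that are continued are such that, for each of the countably many
  good sets \<open>d\<close> with maximum \<open>\<alpha>\<close>, the map sending \<open>\<delta> \<in> d\<close> to the index of \<open>t \<restriction> \<delta>\<close> in a fixed
  enumeration of level \<open>\<delta>\<close> is finite-to-one. The two requirements never interfere: a good set
  avoids \<open>X\<close> and is closed, so it is bounded below each \<open>\<alpha> \<in> X\<close>.

  If \<open>X\<close> is non-stationary, diamond plus yields a good club \<open>C\<close>. A node \<open>t\<close> of height \<open>\<delta> \<in> C\<close> is
  then labelled by its index and the number of \<open>\<eta> \<in> C \<inter> \<delta>\<close> where \<open>t \<restriction> \<eta>\<close> has the same index; these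
  labels are distinct along chains, which specializes the tree on the levels in \<open>C\<close>, hence everywhere.
\<close>

section \<open>Clubs and bounds in the first uncountable ordinal\<close>

lemma strict_supremum_omega1:
  fixes A :: "omega1 set"
  assumes "countable A"
  obtains \<beta> where "\<And>x. x < \<beta> \<longleftrightarrow> (\<exists>a\<in>A. x \<le> a)"
proof -
  have "countable {..a}" for a :: omega1
    using countable_lessThan_omega1[of a] by (simp add: ivl_disj_un_singleton(2)[symmetric])
  then have "countable (\<Union>a\<in>A. {..a})" using assms by simp
  then obtain \<beta>\<^sub>0 where "\<beta>\<^sub>0 \<notin> (\<Union>a\<in>A. {..a})" using uncountable_omega1 by (metis UNIV_eq_I)
  then have \<beta>\<^sub>0: "\<forall>a\<in>A. a < \<beta>\<^sub>0" by (auto simp: not_le)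
  define \<beta> where "\<beta> = (LEAST \<beta>. \<forall>a\<in>A. a < \<beta>)"
  have bound: "\<forall>a\<in>A. a < \<beta>" unfolding \<beta>_def using \<beta>\<^sub>0 by (rule LeastI)
  have "x < \<beta> \<longleftrightarrow> (\<exists>a\<in>A. x \<le> a)" for x
    using bound not_less_Least[of x "\<lambda>\<beta>. \<forall>a\<in>A. a < \<beta>"]
    by (auto simp: \<beta>_def not_less intro: le_less_trans)
  then show ?thesis by (rule that)
qed

lemma bounded_omega1:
  fixes A :: "omega1 set"
  assumes "countable A"
  obtains \<beta> where "\<forall>a\<in>A. a < \<beta>"
  using strict_supremum_omega1[OF assms] that by (metis order_refl)

instance omega1 :: no_top
proof
  fix \<beta> :: omega1
  show "\<exists>\<gamma>. \<beta> < \<gamma>" using bounded_omega1[of "{\<beta>}"] by auto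
qed

definition succ :: "omega1 \<Rightarrow> omega1"
  where "succ \<beta> = (LEAST \<gamma>. \<beta> < \<gamma>)"

lemma less_succ: "\<beta> < succ \<beta>"
  unfolding succ_def using gt_ex by (rule LeastI_ex)

lemma succ_le_iff: "succ \<beta> \<le> \<gamma> \<longleftrightarrow> \<beta> < \<gamma>"
proof
  show "succ \<beta> \<le> \<gamma> \<Longrightarrow> \<beta> < \<gamma>" using less_succ by (rule less_le_trans)
  show "\<beta> < \<gamma> \<Longrightarrow> succ \<beta> \<le> \<gamma>" unfolding succ_def by (rule Least_le)
qed

lemma less_succ_iff: "\<gamma> < succ \<beta> \<longleftrightarrow> \<gamma> \<le> \<beta>"
  using succ_le_iff by (simp add: not_le[symmetric])

lemma lessThan_succ: "{..<succ \<beta>} = insert \<beta> {..<\<beta>}"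
  by (auto simp: less_succ_iff le_less)

definition limit_ord :: "omega1 \<Rightarrow> bool"
  where "limit_ord \<alpha> \<longleftrightarrow> {..<\<alpha>} \<noteq> {} \<and> (\<forall>\<beta><\<alpha>. succ \<beta> < \<alpha>)"

lemma not_limit_ord_succ: "\<not> limit_ord (succ \<beta>)"
  unfolding limit_ord_def using less_succ by blast

lemma omega1_cases:
  obtains (zero) "{..<\<alpha>} = {}" | (succ) \<beta> where "\<alpha> = succ \<beta>" | (limit) "limit_ord \<alpha>"
proof (cases "{..<\<alpha>} = {} \<or> limit_ord \<alpha>")
  case True
  then show ?thesis using zero limit by blast
next
  case False
  then obtain \<beta> where "\<beta> < \<alpha>" "\<not> succ \<beta> < \<alpha>" unfolding limit_ord_def by blast
  then have "\<alpha> = succ \<beta>" using succ_le_iff[of \<beta> \<alpha>] by simp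
  then show ?thesis by (rule succ)
qed

definition closure_points :: "(omega1 \<Rightarrow> omega1) \<Rightarrow> omega1 set"
  where "closure_points g = {\<alpha>. {..<\<alpha>} \<noteq> {} \<and> (\<forall>\<xi><\<alpha>. g \<xi> < \<alpha>)}"

lemma closure_points_less: "\<alpha> \<in> closure_points g \<Longrightarrow> \<xi> < \<alpha> \<Longrightarrow> g \<xi> < \<alpha>"
  by (simp add: closure_points_def)

lemma club_closure_points: "club (closure_points g)"
  unfolding club_def
proof
  show "order_closed (closure_points g)"
    unfolding order_closed_def closure_points_def
    by (blast intro: less_trans)
  show "unbounded (closure_points g)"
    unfolding unbounded_def
  proof
    fix \<alpha>
    have "\<exists>y. x < y \<and> (\<forall>\<xi>\<le>x. g \<xi> < y)" for x
    proof -
      have "countable (insert x (g ` {..<succ x}))" using countable_lessThan_omega1 by simp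
      then obtain y where "\<forall>a\<in>insert x (g ` {..<succ x}). a < y" by (rule bounded_omega1)
      then show ?thesis by (intro exI[of _ y]) (simp add: less_succ_iff)
    qed
    then obtain s where s: "\<And>x. x < s x" "\<And>x \<xi>. \<xi> \<le> x \<Longrightarrow> g \<xi> < s x" by metis
    define h where "h n = (s ^^ n) \<alpha>" for n
    obtain \<beta> where \<beta>: "\<And>x. x < \<beta> \<longleftrightarrow> (\<exists>n. x \<le> h n)"
      using strict_supremum_omega1[of "range h"] by auto
    have h_less: "h n < \<beta>" for n using \<beta>[of "h n"] by blast
    have "g \<xi> < \<beta>" if "\<xi> < \<beta>" for \<xi>
    proof -
      obtain n where "\<xi> \<le> h n" using \<open>\<xi> < \<beta>\<close> \<beta>[of \<xi>] by blast
      then have "g \<xi> < h (Suc n)" by (simp add: h_def s(2))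
      then show ?thesis using h_less by (rule less_trans)
    qed
    moreover have "\<alpha> < \<beta>" using h_less[of 0] by (simp add: h_def)
    ultimately show "\<exists>\<beta>\<in>closure_points g. \<alpha> < \<beta>" unfolding closure_points_def by blast
  qed
qed

lemma unbounded_mono: "unbounded C \<Longrightarrow> C \<subseteq> D \<Longrightarrow> unbounded D"
  unfolding unbounded_def by blast

lemma order_closed_Int: "order_closed C \<Longrightarrow> order_closed D \<Longrightarrow> order_closed (C \<inter> D)"
  unfolding order_closed_def by (metis IntD1 IntD2 IntI)

lemma order_closed_atMost: "order_closed {..\<beta>}"
  unfolding order_closed_def by (meson atMost_iff not_le)

lemma closure_points_subset_club:
  assumes "club C"
  obtains g where "closure_points g \<subseteq> C"
proof -
  have "\<forall>\<xi>. \<exists>\<gamma>\<in>C. \<xi> < \<gamma>" using assms by (auto simp: club_def unbounded_def)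
  then obtain g where g: "\<And>\<xi>. g \<xi> \<in> C \<and> \<xi> < g \<xi>" by metis
  have "closure_points g \<subseteq> C"
  proof
    fix \<alpha> assume "\<alpha> \<in> closure_points g"
    then have "{..<\<alpha>} \<noteq> {}" "\<forall>\<beta><\<alpha>. \<exists>\<gamma>\<in>C. \<beta> < \<gamma> \<and> \<gamma> < \<alpha>"
      using g unfolding closure_points_def by blast+
    then show "\<alpha> \<in> C" using assms unfolding club_def order_closed_def by blast
  qed
  then show ?thesis by (rule that)
qed

lemma club_Int:
  assumes C: "club C" and D: "club D"
  shows "club (C \<inter> D)"
proof -
  obtain g h where gh: "closure_points g \<subseteq> C" "closure_points h \<subseteq> D"
    using closure_points_subset_club C D by metis
  have "closure_points (\<lambda>\<xi>. max (g \<xi>) (h \<xi>)) \<subseteq> C \<inter> D"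
    using gh unfolding closure_points_def by auto
  then have "unbounded (C \<inter> D)"
    using club_closure_points unbounded_mono unfolding club_def by blast
  moreover have "order_closed (C \<inter> D)" using C D order_closed_Int by (simp add: club_def)
  ultimately show ?thesis by (simp add: club_def)
qed

lemma club_limit_ord: "club {\<alpha>. limit_ord \<alpha>}"
  using club_closure_points[of succ] by (simp add: closure_points_def limit_ord_def)

lemma order_closed_Un:
  assumes c: "order_closed c" and d: "order_closed d"
  shows "order_closed (c \<union> d)"
  unfolding order_closed_def
proof (intro allI impI, rule ccontr)
  fix \<alpha>
  assume "{..<\<alpha>} \<noteq> {}" and lim: "\<forall>\<beta><\<alpha>. \<exists>\<gamma>\<in>c \<union> d. \<beta> < \<gamma> \<and> \<gamma> < \<alpha>" and "\<alpha> \<notin> c \<union> d"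
  then obtain \<beta>\<^sub>c \<beta>\<^sub>d where "\<beta>\<^sub>c < \<alpha>" "\<forall>\<gamma>\<in>c. \<beta>\<^sub>c < \<gamma> \<longrightarrow> \<not> \<gamma> < \<alpha>" "\<beta>\<^sub>d < \<alpha>" "\<forall>\<gamma>\<in>d. \<beta>\<^sub>d < \<gamma> \<longrightarrow> \<not> \<gamma> < \<alpha>"
    using c d unfolding order_closed_def by (metis UnCI)
  then show False using lim[rule_format, of "max \<beta>\<^sub>c \<beta>\<^sub>d"] by auto
qed

lemma order_closed_Union:
  assumes "finite D" "\<forall>d\<in>D. order_closed d"
  shows "order_closed (\<Union>D)"
  using assms
proof (induction D rule: finite_induct)
  case empty
  show ?case unfolding order_closed_def by auto
next
  case (insert d D)
  then show ?case by (simp add: order_closed_Un)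
qed

lemma order_closed_gap:
  assumes "order_closed d" "\<alpha> < \<beta>" "\<beta> \<notin> d"
  obtains \<gamma> where "\<alpha> \<le> \<gamma>" "\<gamma> < \<beta>" "d \<inter> {\<gamma><..<\<beta>} = {}"
proof -
  obtain \<gamma> where "\<gamma> < \<beta>" "\<forall>\<delta>\<in>d. \<gamma> < \<delta> \<longrightarrow> \<not> \<delta> < \<beta>"
    using assms unfolding order_closed_def by (metis empty_iff lessThan_iff)
  then have "max \<alpha> \<gamma> < \<beta>" "d \<inter> {max \<alpha> \<gamma><..<\<beta>} = {}" using assms(2) by auto
  then show ?thesis using that[of "max \<alpha> \<gamma>"] by simp
qed

lemma order_closed_greatest_le:
  assumes d: "order_closed d" and "\<delta>\<^sub>0 \<in> d" "\<delta>\<^sub>0 \<le> \<gamma>"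
  obtains \<delta> where "\<delta> \<in> d" "\<delta> \<le> \<gamma>" "\<forall>\<eta>\<in>d. \<eta> \<le> \<gamma> \<longrightarrow> \<eta> \<le> \<delta>"
proof (rule ccontr)
  assume "\<not> thesis"
  with that have no_max: "\<forall>\<delta>\<in>d. \<delta> \<le> \<gamma> \<longrightarrow> (\<exists>\<eta>\<in>d. \<eta> \<le> \<gamma> \<and> \<delta> < \<eta>)"
    by (metis not_le)
  have "countable (d \<inter> {..<succ \<gamma>})" using countable_lessThan_omega1 by (rule countable_Int2)
  then obtain \<sigma> where "\<And>x. x < \<sigma> \<longleftrightarrow> (\<exists>a\<in>d \<inter> {..<succ \<gamma>}. x \<le> a)"
    by (rule strict_supremum_omega1) blast
  then have less_\<sigma>: "x < \<sigma> \<longleftrightarrow> (\<exists>a\<in>d. a \<le> \<gamma> \<and> x \<le> a)" for x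
    by (simp add: less_succ_iff Bex_def conj_assoc)
  have "\<exists>\<eta>\<in>d. \<beta> < \<eta> \<and> \<eta> < \<sigma>" if "\<beta> < \<sigma>" for \<beta>
    using that no_max less_\<sigma> by (meson le_less_trans order_refl)
  moreover have "{..<\<sigma>} \<noteq> {}" using assms less_\<sigma> by blast
  ultimately have "\<sigma> \<in> d" using d unfolding order_closed_def by blast
  moreover have "\<sigma> \<le> \<gamma>" using less_\<sigma>[of \<gamma>] no_max by (metis antisym not_le)
  ultimately show False using less_\<sigma> by blast
qed

definition last_le :: "omega1 set \<Rightarrow> omega1 \<Rightarrow> omega1"
  where "last_le C \<gamma> = (GREATEST \<delta>. \<delta> \<in> C \<and> \<delta> \<le> \<gamma>)"

lemma
  assumes "order_closed C" "\<eta> \<in> C" "\<eta> \<le> \<gamma>"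
  shows last_le_mem: "last_le C \<gamma> \<in> C"
    and last_le_le: "last_le C \<gamma> \<le> \<gamma>"
    and le_last_le: "\<eta> \<le> last_le C \<gamma>"
proof -
  obtain \<delta> where \<delta>: "\<delta> \<in> C" "\<delta> \<le> \<gamma>" "\<forall>\<eta>\<in>C. \<eta> \<le> \<gamma> \<longrightarrow> \<eta> \<le> \<delta>"
    using order_closed_greatest_le[OF assms] .
  then have "last_le C \<gamma> = \<delta>" unfolding last_le_def by (intro Greatest_equality) auto
  then show "last_le C \<gamma> \<in> C" "last_le C \<gamma> \<le> \<gamma>" "\<eta> \<le> last_le C \<gamma>" using \<delta> assms by auto
qed

definition next_gt :: "omega1 set \<Rightarrow> omega1 \<Rightarrow> omega1"
  where "next_gt C \<gamma> = (LEAST \<eta>. \<eta> \<in> C \<and> \<gamma> < \<eta>)"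

lemma
  assumes "unbounded C"
  shows next_gt_mem: "next_gt C \<gamma> \<in> C"
    and less_next_gt: "\<gamma> < next_gt C \<gamma>"
proof -
  have "\<exists>\<eta>. \<eta> \<in> C \<and> \<gamma> < \<eta>" using assms unfolding unbounded_def by blast
  from LeastI_ex[OF this] show "next_gt C \<gamma> \<in> C" "\<gamma> < next_gt C \<gamma>" unfolding next_gt_def by blast+
qed

lemma next_gt_le: "\<eta> \<in> C \<Longrightarrow> \<gamma> < \<eta> \<Longrightarrow> next_gt C \<gamma> \<le> \<eta>"
  unfolding next_gt_def by (intro Least_le) simp

section \<open>Partial functions and binary sequences\<close>

lemma restrict_dom_map_le: "s \<subseteq>\<^sub>m t \<Longrightarrow> t |` dom s = s"
  by (rule ext) (auto simp: map_le_def restrict_map_def domIff)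

lemma restrict_map_le: "t |` A \<subseteq>\<^sub>m t"
  by (auto simp: map_le_def restrict_map_def)

lemma restrict_map_le_agree: "s \<subseteq>\<^sub>m t \<Longrightarrow> A \<subseteq> dom s \<Longrightarrow> t |` A = s |` A"
  by (rule ext) (auto simp: map_le_def restrict_map_def subset_iff)

lemma map_le_SomeD: "s \<subseteq>\<^sub>m t \<Longrightarrow> s x = Some y \<Longrightarrow> t x = Some y"
  unfolding map_le_def by (metis domI)

lemma map_comparable_eq: "s \<subseteq>\<^sub>m t \<or> t \<subseteq>\<^sub>m s \<Longrightarrow> x \<in> dom s \<Longrightarrow> x \<in> dom t \<Longrightarrow> s x = t x"
  unfolding map_le_def by metis

lemma map_le_fun_upd: "x \<notin> dom t \<Longrightarrow> t \<subseteq>\<^sub>m t(x \<mapsto> y)"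
  by (auto simp: map_le_def)

lemma map_chain_upper_bound:
  assumes chain: "\<And>n::nat. t n \<subseteq>\<^sub>m t (Suc n)"
  obtains b where "dom b = (\<Union>n. dom (t n))" "\<And>n. t n \<subseteq>\<^sub>m b"
proof -
  have mono: "t m \<subseteq>\<^sub>m t n" if "m \<le> n" for m n
    using that chain by (induction n rule: dec_induct) (auto intro: map_le_trans)
  define b where "b x = (if \<exists>n. x \<in> dom (t n) then t (LEAST n. x \<in> dom (t n)) x else None)" for x
  have b_eq: "b x = t n x" if n: "x \<in> dom (t n)" for x n
  proof -
    let ?k = "LEAST n. x \<in> dom (t n)"
    have "x \<in> dom (t ?k)" using n by (rule LeastI)
    moreover have "t ?k \<subseteq>\<^sub>m t n" using Least_le[of "\<lambda>n. x \<in> dom (t n)", OF n] by (rule mono)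
    ultimately have "t n x = t ?k x" by (simp add: map_le_def)
    then show ?thesis using n by (simp add: b_def) metis
  qed
  have "dom b = (\<Union>n. dom (t n))"
  proof (intro equalityI subsetI)
    show "x \<in> (\<Union>n. dom (t n))" if "x \<in> dom b" for x
      using that unfolding b_def domIff[of x b] by (metis UN_I UNIV_I)
    show "x \<in> dom b" if "x \<in> (\<Union>n. dom (t n))" for x
      using that b_eq by (metis UN_E domIff)
  qed
  moreover have "t n \<subseteq>\<^sub>m b" for n using b_eq by (simp add: map_le_def)
  ultimately show ?thesis by (rule that)
qed

definition ht :: "binseq \<Rightarrow> omega1"
  where "ht t = (THE \<alpha>. dom t = {..<\<alpha>})"

lemma ht_eqI: "dom t = {..<\<alpha>} \<Longrightarrow> ht t = \<alpha>"
  unfolding ht_def by (simp add: lessThan_eq_iff)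

lemma dom_eq_lessThan_ht: "t \<in> binseqs \<Longrightarrow> dom t = {..<ht t}"
  unfolding binseqs_def using ht_eqI by auto

lemma mem_dom_iff_less_ht: "t \<in> binseqs \<Longrightarrow> \<xi> \<in> dom t \<longleftrightarrow> \<xi> < ht t"
  by (simp add: dom_eq_lessThan_ht)

lemma dom_eq_lessThan_iff: "t \<in> binseqs \<Longrightarrow> dom t = {..<\<alpha>} \<longleftrightarrow> ht t = \<alpha>"
  using ht_eqI dom_eq_lessThan_ht by blast

lemma ht_restrict:
  assumes "{..<\<alpha>} \<subseteq> dom t"
  shows "ht (t |` {..<\<alpha>}) = \<alpha>"
  by (rule ht_eqI) (use assms in \<open>simp add: inf.absorb2\<close>)

lemma restrict_in_binseqs: "{..<\<alpha>} \<subseteq> dom t \<Longrightarrow> t |` {..<\<alpha>} \<in> binseqs"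
  unfolding binseqs_def by (auto simp: inf.absorb2)

lemma ht_le_if_map_le:
  assumes "s \<in> binseqs" "t \<in> binseqs" "s \<subseteq>\<^sub>m t"
  shows "ht s \<le> ht t"
  using map_le_implies_dom_le[OF assms(3)] assms(1,2) by (simp add: dom_eq_lessThan_ht)

lemma ht_less_if_map_le:
  assumes "s \<in> binseqs" "t \<in> binseqs" "s \<subseteq>\<^sub>m t" "s \<noteq> t"
  shows "ht s < ht t"
proof -
  have "dom s \<noteq> dom t" using assms(3,4) map_le_antisym unfolding map_le_def by metis
  then show ?thesis
    using ht_le_if_map_le[OF assms(1-3)] assms(1,2) by (auto simp: dom_eq_lessThan_ht le_less)
qed

section \<open>Downward closed trees of binary sequences\<close>

lemma level_eq_ht:
  assumes "subtree T" "downward_closed T"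
  shows "level T \<xi> = {t \<in> T. ht t = \<xi>}"
  using has_height_iff_dom[OF assms] dom_eq_lessThan_iff assms(1)
  unfolding level_def subtree_def by (metis (no_types, lifting) subsetD)

lemma tree_restrict_eq_levels: "tree_restrict T \<alpha> = (\<Union>\<xi><\<alpha>. level T \<xi>)"
  unfolding tree_restrict_def level_def by blast

lemma countable_tree_restrict:
  assumes "aleph1_subtree T"
  shows "countable (tree_restrict T \<alpha>)"
  using assms countable_lessThan_omega1 unfolding aleph1_subtree_def tree_restrict_eq_levels by simp

lemma restrict_in_downward_closed:
  assumes "downward_closed T" "t \<in> T" "{..<\<alpha>} \<subseteq> dom t"
  shows "t |` {..<\<alpha>} \<in> T"
  using assms restrict_in_binseqs restrict_map_le unfolding downward_closed_def by blast

lemma chain_comparable: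
  assumes "pred_on.chain T (\<subseteq>\<^sub>m) B" "s \<in> B" "t \<in> B"
  shows "s \<subseteq>\<^sub>m t \<or> t \<subseteq>\<^sub>m s"
  using pred_on.chain_total[OF assms] by auto

subsection \<open>Special trees\<close>

lemma special_aronszajn_tree_if_labelled:
  fixes label :: "binseq \<Rightarrow> 'c :: countable"
  assumes T: "aleph1_subtree T"
    and label: "\<And>s t. s \<in> T \<Longrightarrow> t \<in> T \<Longrightarrow> s \<subseteq>\<^sub>m t \<Longrightarrow> s \<noteq> t \<Longrightarrow> label s \<noteq> label t"
  shows "special_aronszajn_tree T"
proof -
  have "countable B" if "branch T B" for B
  proof -
    have chain: "pred_on.chain T (\<subseteq>\<^sub>m) B" using that by (rule pred_on.maxchain_imp_chain)
    then have sub: "B \<subseteq> T" by (simp add: pred_on.chain_def)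
    have "inj_on label B"
    proof (rule inj_onI, rule ccontr)
      fix s t assume st: "s \<in> B" "t \<in> B" "label s = label t" "s \<noteq> t"
      then show False using chain_comparable[OF chain st(1,2)] label[of s t] label[of t s] sub by auto
    qed
    then show ?thesis by (rule countable_image_inj_on[rotated]) simp
  qed
  then have "aronszajn_tree T" unfolding aronszajn_tree_def using T by blast
  moreover have "antichain T {t \<in> T. label t = c}" for c
    unfolding antichain_def using label by fastforce
  moreover have "T = \<Union>(range (\<lambda>c. {t \<in> T. label t = c}))" by blast
  ultimately show ?thesis
    unfolding special_aronszajn_tree_def
    by (intro conjI exI[of _ "range (\<lambda>c. {t \<in> T. label t = c})"]) auto
qed

definition club_projection :: "omega1 set \<Rightarrow> binseq \<Rightarrow> binseq"
  where "club_projection C t = t |` {..<last_le C (ht t)}"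

lemma
  assumes T: "subtree T" "downward_closed T" and C: "order_closed C"
    and t: "t \<in> T" "\<eta> \<in> C" "\<eta> \<le> ht t"
  shows club_projection_mem: "club_projection C t \<in> T"
    and ht_club_projection: "ht (club_projection C t) = last_le C (ht t)"
proof -
  have "t \<in> binseqs" using T(1) t(1) unfolding subtree_def by blast
  then have "{..<last_le C (ht t)} \<subseteq> dom t"
    using last_le_le[OF C t(2,3)] by (simp add: dom_eq_lessThan_ht)
  then show "club_projection C t \<in> T" "ht (club_projection C t) = last_le C (ht t)"
    unfolding club_projection_def using restrict_in_downward_closed T(2) t(1) by (auto simp: ht_restrict)
qed

lemma club_projection_map_le:
  assumes "s \<in> binseqs" "s \<subseteq>\<^sub>m t" "last_le C (ht s) \<le> ht s" "last_le C (ht s) \<le> last_le C (ht t)"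
  shows "club_projection C s \<subseteq>\<^sub>m club_projection C t"
proof -
  have "{..<last_le C (ht s)} \<subseteq> dom s" using assms(1,3) by (simp add: dom_eq_lessThan_ht)
  from restrict_map_le_agree[OF assms(2) this]
  have "club_projection C s = club_projection C t |` {..<last_le C (ht s)}"
    unfolding club_projection_def using assms(4) by (simp add: inf.absorb2)
  then show ?thesis by (metis restrict_map_le)
qed

lemma last_le_less:
  assumes "club C" "\<eta> \<in> C" "\<eta> \<le> \<gamma>" "next_gt C \<gamma> \<le> \<delta>"
  shows "last_le C \<gamma> < last_le C \<delta>"
proof -
  have C: "order_closed C" "unbounded C" using assms(1) by (simp_all add: club_def)
  have "last_le C \<gamma> \<le> \<gamma>" using last_le_le[OF C(1) assms(2,3)] .
  also have "\<gamma> < next_gt C \<gamma>" using less_next_gt[OF C(2)] .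
  also have "next_gt C \<gamma> \<le> last_le C \<delta>" using le_last_le[OF C(1) next_gt_mem[OF C(2)] assms(4)] .
  finally show ?thesis .
qed

lemma club_projection_less:
  assumes T: "subtree T" "downward_closed T" and C: "club C"
    and st: "s \<in> T" "t \<in> T" "s \<subseteq>\<^sub>m t" and \<eta>: "\<eta> \<in> C" "\<eta> \<le> ht s" and next_le: "next_gt C (ht s) \<le> ht t"
  shows "club_projection C s \<subseteq>\<^sub>m club_projection C t \<and> club_projection C s \<noteq> club_projection C t \<and>
    (\<forall>u\<in>{s, t}. club_projection C u \<in> T \<and> ht (club_projection C u) \<in> C)"
proof -
  have closed: "order_closed C" and next_mem: "next_gt C (ht s) \<in> C"
    using C next_gt_mem by (simp_all add: club_def)
  have less: "last_le C (ht s) < last_le C (ht t)" using last_le_less[OF C \<eta> next_le] .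
  have ht: "ht (club_projection C s) = last_le C (ht s)" "ht (club_projection C t) = last_le C (ht t)"
    using ht_club_projection[OF T closed] st(1,2) \<eta> next_mem next_le by blast+
  moreover have "last_le C (ht s) \<in> C" "last_le C (ht t) \<in> C"
    using last_le_mem[OF closed] \<eta> next_mem next_le by blast+
  moreover have "club_projection C s \<in> T" "club_projection C t \<in> T"
    using club_projection_mem[OF T closed] st(1,2) \<eta> next_mem next_le by blast+
  moreover have "club_projection C s \<subseteq>\<^sub>m club_projection C t"
    using st(1,3) T(1) last_le_le[OF closed \<eta>] less
    by (intro club_projection_map_le) (auto simp: subtree_def)
  ultimately show ?thesis using less by auto
qed

text \<open>Between two consecutive levels in \<open>C\<close> there are only countably many nodes, so a node is labelled
  by its rank among them together with the label of its restriction to the last level in \<open>C\<close>.\<close>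

lemma special_aronszajn_tree_if_labelled_on_club:
  fixes label :: "binseq \<Rightarrow> 'c :: countable"
  assumes T: "aleph1_subtree T" "downward_closed T" and C: "club C"
    and label: "\<And>s t. s \<in> T \<Longrightarrow> t \<in> T \<Longrightarrow> ht s \<in> C \<Longrightarrow> ht t \<in> C \<Longrightarrow> s \<subseteq>\<^sub>m t \<Longrightarrow> s \<noteq> t \<Longrightarrow>
      label s \<noteq> label t"
  shows "special_aronszajn_tree T"
proof (rule special_aronszajn_tree_if_labelled[OF T(1)])
  let ?node_label = "\<lambda>t. (if \<exists>\<eta>\<in>C. \<eta> \<le> ht t then Some (label (club_projection C t)) else None,
    to_nat_on (tree_restrict T (next_gt C (ht t))) t)"
  have sub: "subtree T" "T \<subseteq> binseqs" using T(1) by (simp_all add: aleph1_subtree_def subtree_def)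
  have unbounded: "unbounded C" using C by (simp add: club_def)
  fix s t assume st: "s \<in> T" "t \<in> T" "s \<subseteq>\<^sub>m t" "s \<noteq> t"
  then have less: "ht s < ht t" using ht_less_if_map_le sub(2) by blast
  show "?node_label s \<noteq> ?node_label t"
  proof (cases "next_gt C (ht s) \<le> ht t")
    case False
    then have "next_gt C (ht s) = next_gt C (ht t)"
      using next_gt_mem[OF unbounded] less_next_gt[OF unbounded] next_gt_le less
      by (meson less_trans not_le order_antisym)
    moreover have "s \<in> tree_restrict T (next_gt C (ht t))" "t \<in> tree_restrict T (next_gt C (ht t))"
      using st(1,2) less less_trans less_next_gt[OF unbounded]
      by (auto simp: tree_restrict_eq_levels level_eq_ht[OF sub(1) T(2)])
    ultimately show ?thesis using st(4) to_nat_on_inj[OF countable_tree_restrict[OF T(1)]] by auto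
  next
    case next_le: True
    show ?thesis
    proof (cases "\<exists>\<eta>\<in>C. \<eta> \<le> ht s")
      case False
      then show ?thesis using next_le next_gt_mem[OF unbounded] by auto
    next
      case True
      then obtain \<eta> where "\<eta> \<in> C" "\<eta> \<le> ht s" by blast
      then have "label (club_projection C s) \<noteq> label (club_projection C t)"
        using club_projection_less[OF sub(1) T(2) C st(1-3) _ _ next_le] by (intro label) auto
      then show ?thesis using True less by (auto intro: less_imp_le order_trans)
    qed
  qed
qed

subsection \<open>Suslin trees\<close>

definition splitting :: "binseq set \<Rightarrow> bool"
  where "splitting T \<longleftrightarrow> (\<forall>t\<in>T. \<forall>b. t(ht t \<mapsto> b) \<in> T)"

lemma uncountable_chain_imp_path:
  assumes T: "subtree T" "downward_closed T"
    and B: "pred_on.chain T (\<subseteq>\<^sub>m) B" "uncountable B"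
  obtains f where "\<And>\<xi>. (Some \<circ> f) |` {..<\<xi>} \<in> T"
proof -
  have sub: "B \<subseteq> T" "B \<subseteq> binseqs" using B(1) T(1) unfolding pred_on.chain_def subtree_def by blast+
  note comparable = chain_comparable[OF B(1)]
  have "inj_on ht B"
  proof (rule inj_onI, rule ccontr)
    fix s t assume st: "s \<in> B" "t \<in> B" "ht s = ht t" "s \<noteq> t"
    then show False
      using comparable[OF st(1,2)] ht_less_if_map_le[of s t] ht_less_if_map_le[of t s] sub(2) by auto
  qed
  have "\<exists>u\<in>B. \<xi> < ht u" for \<xi>
  proof (rule ccontr)
    assume "\<not> (\<exists>u\<in>B. \<xi> < ht u)"
    then have "ht ` B \<subseteq> {..<succ \<xi>}" by (auto simp: less_succ_iff not_less)
    then have "countable (ht ` B)" using countable_lessThan_omega1 countable_subset by blast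
    then show False using countable_image_inj_on \<open>inj_on ht B\<close> B(2) by blast
  qed
  then obtain u where u: "\<And>\<xi>. u \<xi> \<in> B" "\<And>\<xi>. \<xi> < ht (u \<xi>)" by metis
  have dom_u: "\<xi> \<in> dom (u \<eta>)" if "\<xi> \<le> \<eta>" for \<xi> \<eta>
    using that u[of \<eta>] sub(2) mem_dom_iff_less_ht[of "u \<eta>" \<xi>] by (meson le_less_trans subsetD)
  define f where "f \<xi> = the (u \<xi> \<xi>)" for \<xi>
  have "u \<eta> \<xi> = Some (f \<xi>)" if "\<xi> \<le> \<eta>" for \<xi> \<eta>
  proof -
    have "u \<xi> \<xi> = u \<eta> \<xi>"
      using comparable[OF u(1) u(1)] dom_u[OF order_refl] dom_u[OF that] by (rule map_comparable_eq)
    then show ?thesis unfolding f_def using dom_u[of \<xi> \<xi>] by (metis domD option.sel order_refl)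
  qed
  then have "(Some \<circ> f) |` {..<\<xi>} = u \<xi> |` {..<\<xi>}" for \<xi>
    by (auto simp: restrict_map_def)
  moreover have "u \<xi> |` {..<\<xi>} \<in> T" for \<xi>
    using restrict_in_downward_closed[OF T(2)] u(1) sub(1) dom_u by (simp add: less_imp_le subset_iff)
  ultimately show ?thesis using that by metis
qed

text \<open>The nodes branching off a path form an antichain.\<close>

lemma path_imp_uncountable_antichain:
  assumes T: "splitting T" and f: "\<And>\<xi>. (Some \<circ> f) |` {..<\<xi>} \<in> T"
  obtains A where "antichain T A" "uncountable A"
proof -
  define a where "a \<xi> = ((Some \<circ> f) |` {..<\<xi>})(\<xi> \<mapsto> \<not> f \<xi>)" for \<xi>
  have incomparable: "\<not> a \<xi> \<subseteq>\<^sub>m a \<eta> \<and> \<not> a \<eta> \<subseteq>\<^sub>m a \<xi>" if "\<xi> < \<eta>" for \<xi> \<eta>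
  proof -
    have "a \<xi> \<xi> = Some (\<not> f \<xi>)" "a \<eta> \<xi> = Some (f \<xi>)" using that by (auto simp: a_def)
    then show ?thesis by (metis map_le_SomeD option.inject)
  qed
  have "inj a"
    by (rule linorder_injI) (metis incomparable map_le_refl)
  then have "uncountable (range a)" using uncountable_omega1 countable_image_inj_on by blast
  moreover have "a \<xi> \<in> T" for \<xi>
  proof -
    have "ht ((Some \<circ> f) |` {..<\<xi>}) = \<xi>" by (rule ht_eqI) (auto simp: dom_def restrict_map_def)
    then show ?thesis using T f[of \<xi>] unfolding splitting_def a_def by metis
  qed
  then have "antichain T (range a)"
    unfolding antichain_def using incomparable
    by (auto simp: neq_iff) (metis linorder_neqE incomparable)+
  ultimately show ?thesis using that by blast
qed

lemma suslin_tree_if_antichains_countable: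
  assumes T: "aleph1_subtree T" "downward_closed T" "splitting T"
    and countable: "\<And>A. antichain T A \<Longrightarrow> countable A"
  shows "suslin_tree T"
proof -
  have "countable B" if B: "branch T B" for B
  proof (rule ccontr)
    assume "uncountable B"
    then obtain f where "\<And>\<xi>. (Some \<circ> f) |` {..<\<xi>} \<in> T"
      using uncountable_chain_imp_path T(1,2) pred_on.maxchain_imp_chain[OF B]
      unfolding aleph1_subtree_def by metis
    then show False using path_imp_uncountable_antichain[OF T(3)] countable by metis
  qed
  then show ?thesis
    unfolding suslin_tree_def aronszajn_tree_def using T(1) countable by blast
qed

section \<open>Levels, cofinal branches and indices\<close>

definition nodes :: "(omega1 \<Rightarrow> binseq set) \<Rightarrow> omega1 \<Rightarrow> binseq set"
  where "nodes P \<alpha> = (\<Union>\<beta><\<alpha>. P \<beta>)"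

definition cofinal_branch :: "(omega1 \<Rightarrow> binseq set) \<Rightarrow> omega1 \<Rightarrow> binseq \<Rightarrow> bool"
  where "cofinal_branch P \<alpha> b \<longleftrightarrow> dom b = {..<\<alpha>} \<and> (\<forall>\<beta><\<alpha>. b |` {..<\<beta>} \<in> P \<beta>)"

definition index :: "(omega1 \<Rightarrow> binseq set) \<Rightarrow> binseq \<Rightarrow> omega1 \<Rightarrow> nat"
  where "index P t \<delta> = to_nat_on (P \<delta>) (t |` {..<\<delta>})"

definition index_ge_on :: "(omega1 \<Rightarrow> binseq set) \<Rightarrow> nat \<Rightarrow> omega1 set \<Rightarrow> binseq \<Rightarrow> bool"
  where "index_ge_on P N E t \<longleftrightarrow> (\<forall>\<delta>\<in>E. N \<le> index P t \<delta>)"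

definition index_finite_to_one_on :: "(omega1 \<Rightarrow> binseq set) \<Rightarrow> omega1 set \<Rightarrow> binseq \<Rightarrow> bool"
  where "index_finite_to_one_on P E t \<longleftrightarrow> (\<forall>N. finite {\<delta> \<in> E. index P t \<delta> < N})"

definition decides :: "binseq set \<Rightarrow> binseq \<Rightarrow> bool"
  where "decides A t \<longleftrightarrow> (\<exists>s\<in>A. s \<subseteq>\<^sub>m t) \<or> (\<forall>s\<in>A. \<not> t \<subseteq>\<^sub>m s)"

lemma cofinal_branch_dom: "cofinal_branch P \<alpha> b \<Longrightarrow> dom b = {..<\<alpha>}"
  and cofinal_branch_restrict: "cofinal_branch P \<alpha> b \<Longrightarrow> \<beta> < \<alpha> \<Longrightarrow> b |` {..<\<beta>} \<in> P \<beta>"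
  by (simp_all add: cofinal_branch_def)

lemma index_map_le:
  assumes "s \<subseteq>\<^sub>m t" "{..<\<delta>} \<subseteq> dom s"
  shows "index P t \<delta> = index P s \<delta>"
  unfolding index_def using restrict_map_le_agree[OF assms] by simp

lemma index_ge_on_mono: "index_ge_on P N E t \<Longrightarrow> F \<subseteq> E \<Longrightarrow> M \<le> N \<Longrightarrow> index_ge_on P M F t"
  unfolding index_ge_on_def by (meson order_trans subsetD)

lemma index_ge_on_Un: "index_ge_on P N (E \<union> F) t \<longleftrightarrow> index_ge_on P N E t \<and> index_ge_on P N F t"
  unfolding index_ge_on_def by blast

lemma index_ge_on_map_le:
  assumes "s \<subseteq>\<^sub>m t" "\<And>\<delta>. \<delta> \<in> E \<Longrightarrow> {..<\<delta>} \<subseteq> dom s"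
  shows "index_ge_on P N E t \<longleftrightarrow> index_ge_on P N E s"
  unfolding index_ge_on_def using index_map_le[OF assms] by simp

lemma decides_map_le: "decides A t \<Longrightarrow> t \<subseteq>\<^sub>m t' \<Longrightarrow> decides A t'"
  unfolding decides_def by (meson map_le_trans)

section \<open>Guesses from diamond plus\<close>

locale guessing =
  fixes \<A> :: "omega1 \<Rightarrow> omega1 set set" and \<S> :: "omega1 \<Rightarrow> binseq set set"
  assumes countable_\<A>: "countable (\<A> \<alpha>)" and countable_\<S>: "countable (\<S> \<alpha>)"
    and club_guess: "club D \<Longrightarrow> \<exists>C\<subseteq>D. club C \<and> (\<forall>\<alpha>\<in>C. C \<inter> {..<\<alpha>} \<in> \<A> \<alpha>)"
    and node_guess: "\<forall>\<xi>. countable (P \<xi>) \<and> P \<xi> \<subseteq> binseqs \<Longrightarrow>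
      \<exists>C. club C \<and> (\<forall>\<alpha>\<in>C. \<exists>S\<in>\<S> \<alpha>. S \<inter> nodes P \<alpha> = A \<inter> nodes P \<alpha>)"

lemma inj_omega1_times_omega1_times_nat: "\<exists>\<pi> :: omega1 \<times> omega1 \<times> nat \<Rightarrow> omega1. inj \<pi>"
proof -
  let ?\<Omega> = "UNIV :: omega1 set" and ?\<omega> = "UNIV :: nat set"
  have inf: "infinite ?\<Omega>" using uncountable_omega1 countable_finite by blast
  then have square: "ordIso2 (card_of (?\<Omega> \<times> ?\<Omega>)) (card_of ?\<Omega>)"
    by (rule card_of_Times_same_infinite)
  have "ordLeq3 (card_of ?\<omega>) (card_of ?\<Omega>)"
    using inf by (simp add: infinite_iff_card_of_nat)
  then have "ordIso2 (card_of (?\<Omega> \<times> ?\<omega>)) (card_of ?\<Omega>)"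
    using card_of_Times_infinite[of ?\<Omega> ?\<omega>] inf by blast
  then obtain f :: "omega1 \<times> nat \<Rightarrow> omega1" where "bij_betw f (UNIV \<times> UNIV) UNIV"
    unfolding card_of_ordIso[symmetric] ..
  moreover obtain g :: "omega1 \<times> omega1 \<Rightarrow> omega1" where "bij_betw g (UNIV \<times> UNIV) UNIV"
    using square unfolding card_of_ordIso[symmetric] ..
  ultimately have "inj f" "inj g" by (simp_all add: bij_betw_def)
  then have "inj (\<lambda>(\<alpha>, \<beta>, n). g (\<alpha>, f (\<beta>, n)))" by (auto intro!: injI simp: inj_eq)
  then show ?thesis by (intro exI)
qed

lemma diamond_plus_imp_diamond_star:
  assumes diamond_plus
  obtains \<D> :: "omega1 \<Rightarrow> omega1 set set"
  where "\<forall>\<alpha>. countable (\<D> \<alpha>)" and "\<forall>X. \<exists>C. club C \<and> (\<forall>\<alpha>\<in>C. X \<inter> {..<\<alpha>} \<in> \<D> \<alpha>)"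
  using assms unfolding diamond_plus_def by metis

text \<open>Diamond plus implies the continuum hypothesis: a bounded set is one of the countably many guesses
  at a sufficiently large \<open>\<alpha>\<close>.\<close>

lemma diamond_plus_imp_inj_on_binseqs:
  assumes diamond_plus
  obtains \<pi> :: "binseq \<Rightarrow> omega1" where "inj_on \<pi> binseqs"
proof -
  obtain \<D> where \<D>: "\<forall>\<alpha>. countable (\<D> \<alpha>)" and guess: "\<forall>X. \<exists>C. club C \<and> (\<forall>\<alpha>\<in>C. X \<inter> {..<\<alpha>} \<in> \<D> \<alpha>)"
    using diamond_plus_imp_diamond_star[OF assms] .
  have "\<forall>t\<in>binseqs. \<exists>c. case c of (\<beta>, \<alpha>, n) \<Rightarrow>
    dom t = {..<\<beta>} \<and> {\<xi>. t \<xi> = Some True} = from_nat_into (\<D> \<alpha>) n"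
  proof
    fix t assume t: "t \<in> binseqs"
    let ?X = "{\<xi>. t \<xi> = Some True}"
    obtain C where C: "club C" "\<forall>\<alpha>\<in>C. ?X \<inter> {..<\<alpha>} \<in> \<D> \<alpha>" using guess by blast
    then obtain \<alpha> where "\<alpha> \<in> C" "ht t < \<alpha>" unfolding club_def unbounded_def by metis
    moreover have "?X \<subseteq> dom t" by auto
    ultimately have "?X \<inter> {..<\<alpha>} = ?X" using dom_eq_lessThan_ht[OF t] by auto
    then have "?X \<in> \<D> \<alpha>" using C(2) \<open>\<alpha> \<in> C\<close> by metis
    then obtain n where "from_nat_into (\<D> \<alpha>) n = ?X" using from_nat_into_surj[OF \<D>[rule_format]] by blast
    then show "\<exists>c. case c of (\<beta>, \<alpha>, n) \<Rightarrow> dom t = {..<\<beta>} \<and> ?X = from_nat_into (\<D> \<alpha>) n"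
      using dom_eq_lessThan_ht[OF t] by (intro exI[of _ "(ht t, \<alpha>, n)"]) simp
  qed
  from bchoice[OF this] obtain code where code: "\<forall>t\<in>binseqs. case code t of (\<beta>, \<alpha>, n) \<Rightarrow>
    dom t = {..<\<beta>} \<and> {\<xi>. t \<xi> = Some True} = from_nat_into (\<D> \<alpha>) n" ..
  have "inj_on code binseqs"
  proof (rule inj_onI)
    fix s t assume "s \<in> binseqs" "t \<in> binseqs" "code s = code t"
    then have "dom s = dom t" "{\<xi>. s \<xi> = Some True} = {\<xi>. t \<xi> = Some True}"
      using bspec[OF code, of s] bspec[OF code, of t] by (auto split: prod.splits)
    then have "s \<xi> = None \<longleftrightarrow> t \<xi> = None" "s \<xi> = Some True \<longleftrightarrow> t \<xi> = Some True" for \<xi>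
      by (metis domIff, simp add: set_eq_iff)
    then show "s = t" by (intro ext) (metis (full_types) not_None_eq)
  qed
  moreover obtain \<pi> :: "omega1 \<times> omega1 \<times> nat \<Rightarrow> omega1" where "inj \<pi>"
    using inj_omega1_times_omega1_times_nat by blast
  ultimately have "inj_on (\<pi> \<circ> code) binseqs" by (metis comp_inj_on inj_on_subset subset_UNIV)
  then show ?thesis by (rule that)
qed

lemma diamond_plus_imp_node_guesses:
  assumes diamond_plus
  obtains \<S> :: "omega1 \<Rightarrow> binseq set set"
  where "\<forall>\<alpha>. countable (\<S> \<alpha>)"
    and "\<forall>P A. (\<forall>\<xi>. countable (P \<xi>) \<and> P \<xi> \<subseteq> binseqs) \<longrightarrow>
      (\<exists>C. club C \<and> (\<forall>\<alpha>\<in>C. \<exists>S\<in>\<S> \<alpha>. S \<inter> nodes P \<alpha> = A \<inter> nodes P \<alpha>))"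
proof -
  obtain \<D> where \<D>: "\<forall>\<alpha>. countable (\<D> \<alpha>)" and guess: "\<forall>X. \<exists>C. club C \<and> (\<forall>\<alpha>\<in>C. X \<inter> {..<\<alpha>} \<in> \<D> \<alpha>)"
    using diamond_plus_imp_diamond_star[OF assms] .
  obtain \<pi> :: "binseq \<Rightarrow> omega1" where \<pi>: "inj_on \<pi> binseqs"
    using diamond_plus_imp_inj_on_binseqs[OF assms] .
  define \<S> where "\<S> \<alpha> = (\<lambda>a. {s. \<pi> s \<in> a}) ` \<D> \<alpha>" for \<alpha>
  have "\<exists>C. club C \<and> (\<forall>\<alpha>\<in>C. \<exists>S\<in>\<S> \<alpha>. S \<inter> nodes P \<alpha> = A \<inter> nodes P \<alpha>)"
    if P: "\<forall>\<xi>. countable (P \<xi>) \<and> P \<xi> \<subseteq> binseqs" for P A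
  proof -
    obtain C where C: "club C" "\<forall>\<alpha>\<in>C. \<pi> ` (A \<inter> binseqs) \<inter> {..<\<alpha>} \<in> \<D> \<alpha>" using guess by blast
    have "\<exists>\<gamma>. \<forall>s\<in>P \<xi>. \<pi> s < \<gamma>" for \<xi>
    proof -
      have "countable (\<pi> ` P \<xi>)" using P by simp
      then obtain \<gamma> where "\<forall>a\<in>\<pi> ` P \<xi>. a < \<gamma>" by (rule bounded_omega1)
      then show ?thesis by auto
    qed
    then obtain g where g: "\<And>\<xi> s. s \<in> P \<xi> \<Longrightarrow> \<pi> s < g \<xi>" by metis
    have "\<exists>S\<in>\<S> \<alpha>. S \<inter> nodes P \<alpha> = A \<inter> nodes P \<alpha>" if \<alpha>: "\<alpha> \<in> C \<inter> closure_points g" for \<alpha>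
    proof
      show "{s. \<pi> s \<in> \<pi> ` (A \<inter> binseqs) \<inter> {..<\<alpha>}} \<in> \<S> \<alpha>" unfolding \<S>_def using C(2) \<alpha> by blast
      have "\<pi> s < \<alpha>" "s \<in> binseqs" if "s \<in> nodes P \<alpha>" for s
        using that g closure_points_less[of \<alpha> g] \<alpha> P unfolding nodes_def by (auto intro: less_trans)
      moreover have "\<pi> s \<in> \<pi> ` (A \<inter> binseqs) \<longleftrightarrow> s \<in> A" if "s \<in> binseqs" for s
        using inj_on_image_mem_iff[OF \<pi> that Int_lower2] that by blast
      ultimately show "{s. \<pi> s \<in> \<pi> ` (A \<inter> binseqs) \<inter> {..<\<alpha>}} \<inter> nodes P \<alpha> = A \<inter> nodes P \<alpha>"
        by blast
    qed
    then show ?thesis using club_Int[OF C(1) club_closure_points] by blast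
  qed
  then show ?thesis using that[of \<S>] \<D> by (simp add: \<S>_def)
qed

lemma diamond_plus_imp_club_guesses:
  assumes diamond_plus
  obtains \<A> :: "omega1 \<Rightarrow> omega1 set set"
  where "\<forall>\<alpha>. countable (\<A> \<alpha>)" and "\<forall>D. club D \<longrightarrow> (\<exists>C\<subseteq>D. club C \<and> (\<forall>\<alpha>\<in>C. C \<inter> {..<\<alpha>} \<in> \<A> \<alpha>))"
proof -
  obtain \<D> :: "omega1 \<Rightarrow> omega1 set set" where \<D>: "\<And>\<alpha>. countable (\<D> \<alpha>)"
    and guess: "\<And>X. \<exists>C. club C \<and> (\<forall>\<alpha>\<in>C. C \<inter> {..<\<alpha>} \<in> \<D> \<alpha> \<and> X \<inter> {..<\<alpha>} \<in> \<D> \<alpha>)"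
    using assms unfolding diamond_plus_def by blast
  define \<A> where "\<A> \<alpha> = (\<lambda>(c, d). c \<inter> d) ` (\<D> \<alpha> \<times> \<D> \<alpha>)" for \<alpha>
  have "\<exists>C\<subseteq>D. club C \<and> (\<forall>\<alpha>\<in>C. C \<inter> {..<\<alpha>} \<in> \<A> \<alpha>)" if D: "club D" for D
  proof -
    obtain C where C: "club C" "\<forall>\<alpha>\<in>C. C \<inter> {..<\<alpha>} \<in> \<D> \<alpha> \<and> D \<inter> {..<\<alpha>} \<in> \<D> \<alpha>" using guess by blast
    have "C \<inter> D \<inter> {..<\<alpha>} \<in> \<A> \<alpha>" if "\<alpha> \<in> C \<inter> D" for \<alpha>
    proof -
      have "(C \<inter> {..<\<alpha>}, D \<inter> {..<\<alpha>}) \<in> \<D> \<alpha> \<times> \<D> \<alpha>" using C(2) that by simp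
      moreover have "C \<inter> D \<inter> {..<\<alpha>} = (\<lambda>(c, d). c \<inter> d) (C \<inter> {..<\<alpha>}, D \<inter> {..<\<alpha>})" by auto
      ultimately show ?thesis unfolding \<A>_def by (rule rev_image_eqI)
    qed
    then show ?thesis using club_Int[OF C(1) D] by blast
  qed
  moreover have "countable (\<A> \<alpha>)" for \<alpha> by (simp add: \<A>_def \<D>)
  ultimately show ?thesis using that by blast
qed

lemma diamond_plus_imp_guessing:
  assumes diamond_plus
  obtains \<A> \<S> where "guessing \<A> \<S>"
proof -
  obtain \<A> where "\<forall>\<alpha>. countable (\<A> \<alpha>)" "\<forall>D. club D \<longrightarrow> (\<exists>C\<subseteq>D. club C \<and> (\<forall>\<alpha>\<in>C. C \<inter> {..<\<alpha>} \<in> \<A> \<alpha>))"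
    using diamond_plus_imp_club_guesses[OF assms] .
  moreover obtain \<S> where "\<forall>\<alpha>. countable (\<S> \<alpha>)"
    "\<forall>P A. (\<forall>\<xi>. countable (P \<xi>) \<and> P \<xi> \<subseteq> binseqs) \<longrightarrow>
      (\<exists>C. club C \<and> (\<forall>\<alpha>\<in>C. \<exists>S\<in>\<S> \<alpha>. S \<inter> nodes P \<alpha> = A \<inter> nodes P \<alpha>))"
    using diamond_plus_imp_node_guesses[OF assms] .
  ultimately have "guessing \<A> \<S>" by unfold_locales simp_all
  then show ?thesis by (rule that)
qed

section \<open>Requirements on the levels\<close>

context guessing
begin

definition good :: "omega1 set \<Rightarrow> omega1 set \<Rightarrow> bool"
  where "good X d \<longleftrightarrow> order_closed d \<and> d \<inter> X = {} \<and> (\<forall>\<delta>\<in>d. limit_ord \<delta> \<and> d \<inter> {..<\<delta>} \<in> \<A> \<delta>)"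

definition good_with_max :: "omega1 set \<Rightarrow> omega1 \<Rightarrow> omega1 set set"
  where "good_with_max X \<alpha> = {d. good X d \<and> d \<subseteq> {..\<alpha>} \<and> \<alpha> \<in> d}"

definition admissible_branch :: "omega1 set \<Rightarrow> omega1 \<Rightarrow> (omega1 \<Rightarrow> binseq set) \<Rightarrow> binseq \<Rightarrow> bool"
  where "admissible_branch X \<alpha> P b \<longleftrightarrow>
    cofinal_branch P \<alpha> b \<and>
    (\<forall>d\<in>good_with_max X \<alpha>. index_finite_to_one_on P (d \<inter> {..<\<alpha>}) b) \<and>
    (\<alpha> \<in> X \<longrightarrow> limit_ord \<alpha> \<longrightarrow> (\<forall>S\<in>\<S> \<alpha>. \<exists>\<beta><\<alpha>. decides (S \<inter> nodes P \<alpha>) (b |` {..<\<beta>})))"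

text \<open>In the last clause, only the indices strictly above the given node \<open>t\<close> can be asked to be large,
  since those at and below \<open>t\<close> are fixed.\<close>

definition admissible_level :: "omega1 set \<Rightarrow> omega1 \<Rightarrow> (omega1 \<Rightarrow> binseq set) \<Rightarrow> binseq set \<Rightarrow> bool"
  where "admissible_level X \<alpha> P L \<longleftrightarrow>
    countable L \<and> L \<noteq> {} \<and>
    (\<forall>b\<in>L. admissible_branch X \<alpha> P b) \<and>
    (\<forall>\<beta>. \<alpha> = succ \<beta> \<longrightarrow> (\<forall>t\<in>P \<beta>. \<forall>i. t(\<beta> \<mapsto> i) \<in> L)) \<and>
    (\<forall>t\<in>nodes P \<alpha>. \<forall>R\<in>Fpow (good_with_max X \<alpha>). \<forall>N.
      \<exists>b\<in>L. t \<subseteq>\<^sub>m b \<and> index_ge_on P N (\<Union>R \<inter> {ht t<..<\<alpha>}) b)"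

lemma
  assumes "admissible_level X \<alpha> P L"
  shows admissible_level_countable: "countable L"
    and admissible_level_nonempty: "L \<noteq> {}"
    and admissible_level_branch: "b \<in> L \<Longrightarrow> admissible_branch X \<alpha> P b"
    and admissible_level_split: "\<alpha> = succ \<beta> \<Longrightarrow> t \<in> P \<beta> \<Longrightarrow> t(\<beta> \<mapsto> i) \<in> L"
    and admissible_level_extend: "t \<in> nodes P \<alpha> \<Longrightarrow> R \<in> Fpow (good_with_max X \<alpha>) \<Longrightarrow>
      \<exists>b\<in>L. t \<subseteq>\<^sub>m b \<and> index_ge_on P N (\<Union>R \<inter> {ht t<..<\<alpha>}) b"
  using assms unfolding admissible_level_def by blast+

lemma
  assumes "admissible_branch X \<alpha> P b"
  shows admissible_branch_cofinal: "cofinal_branch P \<alpha> b"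
    and admissible_branch_index: "d \<in> good_with_max X \<alpha> \<Longrightarrow> index_finite_to_one_on P (d \<inter> {..<\<alpha>}) b"
    and admissible_branch_decides: "\<alpha> \<in> X \<Longrightarrow> limit_ord \<alpha> \<Longrightarrow> S \<in> \<S> \<alpha> \<Longrightarrow>
      \<exists>\<beta><\<alpha>. decides (S \<inter> nodes P \<alpha>) (b |` {..<\<beta>})"
  using assms unfolding admissible_branch_def by blast+

lemma good_imp_order_closed: "good X d \<Longrightarrow> order_closed d"
  and good_imp_limit_ord: "good X d \<Longrightarrow> \<delta> \<in> d \<Longrightarrow> limit_ord \<delta>"
  by (simp_all add: good_def)

lemma countable_good_with_max: "countable (good_with_max X \<alpha>)"
proof -
  have "good_with_max X \<alpha> \<subseteq> insert \<alpha> ` \<A> \<alpha>"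
  proof
    fix d assume "d \<in> good_with_max X \<alpha>"
    then have "d \<inter> {..<\<alpha>} \<in> \<A> \<alpha>" "d = insert \<alpha> (d \<inter> {..<\<alpha>})"
      by (auto simp: good_with_max_def good_def le_less)
    then show "d \<in> insert \<alpha> ` \<A> \<alpha>" by blast
  qed
  then show ?thesis using countable_\<A> countable_subset countable_image by metis
qed

lemma good_with_max_empty: "\<alpha> \<in> X \<or> \<not> limit_ord \<alpha> \<Longrightarrow> good_with_max X \<alpha> = {}"
  by (auto simp: good_with_max_def good_def)

lemma good_Int_atMost:
  assumes d: "good X d" and \<beta>: "\<beta> \<in> d"
  shows "d \<inter> {..\<beta>} \<in> good_with_max X \<beta>"
proof -
  have "order_closed (d \<inter> {..\<beta>})"
    using good_imp_order_closed[OF d] order_closed_atMost by (rule order_closed_Int)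
  moreover have "d \<inter> {..\<beta>} \<inter> {..<\<delta>} = d \<inter> {..<\<delta>}" if "\<delta> \<le> \<beta>" for \<delta>
    using that by auto
  ultimately show ?thesis using d \<beta> by (auto simp: good_with_max_def good_def)
qed

lemma good_with_max_cong:
  assumes X: "X \<inter> {..\<alpha>} = Y \<inter> {..\<alpha>}"
  shows "good_with_max X \<alpha> = good_with_max Y \<alpha>"
proof -
  have "d \<inter> X = d \<inter> Y" if "d \<subseteq> {..\<alpha>}" for d using that X by blast
  then have "good X d \<longleftrightarrow> good Y d" if "d \<subseteq> {..\<alpha>}" for d unfolding good_def using that by simp
  then show ?thesis unfolding good_with_max_def by blast
qed

lemma admissible_level_cong:
  assumes P: "\<And>\<beta>. \<beta> < \<alpha> \<Longrightarrow> P \<beta> = Q \<beta>" and X: "X \<inter> {..\<alpha>} = Y \<inter> {..\<alpha>}"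
  shows "admissible_level X \<alpha> P L \<longleftrightarrow> admissible_level Y \<alpha> Q L"
proof -
  have nodes: "nodes P \<alpha> = nodes Q \<alpha>" using P by (simp add: nodes_def)
  have index: "index P t \<delta> = index Q t \<delta>" if "\<delta> < \<alpha>" for t \<delta> using P that by (simp add: index_def)
  have large: "index_ge_on P N (E \<inter> {\<gamma><..<\<alpha>}) b \<longleftrightarrow> index_ge_on Q N (E \<inter> {\<gamma><..<\<alpha>}) b" for N E \<gamma> b
    by (simp add: index_ge_on_def index)
  have "{\<delta> \<in> E \<inter> {..<\<alpha>}. index P b \<delta> < N} = {\<delta> \<in> E \<inter> {..<\<alpha>}. index Q b \<delta> < N}" for E b N
    using index by auto
  then have finite_to_one:
    "index_finite_to_one_on P (E \<inter> {..<\<alpha>}) b \<longleftrightarrow> index_finite_to_one_on Q (E \<inter> {..<\<alpha>}) b" for E b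
    by (simp add: index_finite_to_one_on_def)
  have "cofinal_branch P \<alpha> b \<longleftrightarrow> cofinal_branch Q \<alpha> b" for b
    using P by (simp add: cofinal_branch_def)
  moreover have "\<alpha> \<in> X \<longleftrightarrow> \<alpha> \<in> Y" using X by blast
  ultimately have branch: "admissible_branch X \<alpha> P b \<longleftrightarrow> admissible_branch Y \<alpha> Q b" for b
    unfolding admissible_branch_def by (simp only: nodes finite_to_one good_with_max_cong[OF X])
  have "P \<beta> = Q \<beta>" if "\<alpha> = succ \<beta>" for \<beta> using P less_succ that by simp
  then show ?thesis
    unfolding admissible_level_def
    by (simp add: nodes large branch good_with_max_cong[OF X] cong: imp_cong)
qed

end

section \<open>Extending nodes in a partial tree\<close>

locale partial_tree = guessing +
  fixes X :: "omega1 set" and P :: "omega1 \<Rightarrow> binseq set" and I :: "omega1 set"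
  assumes initial_segment: "\<beta> \<in> I \<Longrightarrow> \<gamma> \<le> \<beta> \<Longrightarrow> \<gamma> \<in> I"
    and admissible: "\<beta> \<in> I \<Longrightarrow> admissible_level X \<beta> P (P \<beta>)"
begin

lemma countable_level: "\<beta> \<in> I \<Longrightarrow> countable (P \<beta>)"
  and level_nonempty: "\<beta> \<in> I \<Longrightarrow> P \<beta> \<noteq> {}"
  and admissible_node: "\<beta> \<in> I \<Longrightarrow> t \<in> P \<beta> \<Longrightarrow> admissible_branch X \<beta> P t"
  and split_node: "succ \<beta> \<in> I \<Longrightarrow> t \<in> P \<beta> \<Longrightarrow> t(\<beta> \<mapsto> i) \<in> P (succ \<beta>)"
  by (simp_all add: admissible_level_countable[OF admissible] admissible_level_nonempty[OF admissible]
      admissible_level_branch[OF admissible] admissible_level_split[OF admissible])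

lemma dom_node: "\<beta> \<in> I \<Longrightarrow> t \<in> P \<beta> \<Longrightarrow> dom t = {..<\<beta>}"
  using admissible_branch_cofinal cofinal_branch_dom admissible_node by blast

lemma ht_node: "\<beta> \<in> I \<Longrightarrow> t \<in> P \<beta> \<Longrightarrow> ht t = \<beta>"
  using dom_node by (rule ht_eqI)

lemma restrict_node:
  assumes "\<beta> \<in> I" "t \<in> P \<beta>" "\<gamma> \<le> \<beta>"
  shows "t |` {..<\<gamma>} \<in> P \<gamma>"
proof (cases "\<gamma> = \<beta>")
  case True
  then show ?thesis using assms restrict_dom_map_le[of t t] dom_node by simp
next
  case False
  then show ?thesis
    using assms(3) cofinal_branch_restrict[OF admissible_branch_cofinal[OF admissible_node]] assms(1,2)
    by simp
qed

lemma extend_node: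
  assumes "\<beta> \<in> I" "\<gamma> \<le> \<beta>" "t \<in> P \<gamma>"
  obtains t' where "t' \<in> P \<beta>" "t \<subseteq>\<^sub>m t'"
proof (cases "\<gamma> = \<beta>")
  case True
  then show ?thesis using that assms(3) map_le_refl by blast
next
  case False
  then have "t \<in> nodes P \<beta>" unfolding nodes_def using assms by auto
  then show ?thesis
    using that admissible_level_extend[OF admissible[OF assms(1)], of t "{}"]
    by (auto simp: Fpow_def)
qed

lemma countable_nodes: "{..<\<alpha>} \<subseteq> I \<Longrightarrow> countable (nodes P \<alpha>)"
  unfolding nodes_def using countable_lessThan_omega1 countable_level by (intro countable_UN) auto

text \<open>The extensions of \<open>t(\<gamma> \<mapsto> False)\<close> are extensions of \<open>t\<close>, but \<open>t\<close> has further ones through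
  \<open>t(\<gamma> \<mapsto> True)\<close>, so a finite set of extensions would lead to a smaller one. No index condition is lost
  on the way, as a good set contains no successor.\<close>

lemma infinite_large_extensions:
  assumes \<beta>: "\<beta> \<in> I" "limit_ord \<beta>" and R: "R \<in> Fpow (good_with_max X \<beta>)"
    and "t \<in> P \<gamma>" "\<gamma> < \<beta>"
  shows "infinite {t' \<in> P \<beta>. t \<subseteq>\<^sub>m t' \<and> index_ge_on P N (\<Union>R \<inter> {\<gamma><..<\<beta>}) t'}" (is "infinite (?E \<gamma> t)")
  using assms(4,5)
proof (induction "card (?E \<gamma> t)" arbitrary: \<gamma> t rule: less_induct)
  case less
  show ?case
  proof
    assume fin: "finite (?E \<gamma> t)"
    have \<gamma>: "\<gamma> \<in> I" "succ \<gamma> \<in> I" "succ \<gamma> < \<beta>"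
      using \<beta> less.prems initial_segment unfolding limit_ord_def by (auto dest: less_imp_le)
    have "\<gamma> \<notin> dom t" using dom_node[OF \<gamma>(1) less.prems(1)] by simp
    then have t_le: "t \<subseteq>\<^sub>m t(\<gamma> \<mapsto> i)" for i by (rule map_le_fun_upd)
    have "succ \<gamma> \<notin> \<Union>R"
      using R good_imp_limit_ord not_limit_ord_succ unfolding Fpow_def good_with_max_def by blast
    then have "\<forall>\<delta>\<in>\<Union>R. \<gamma> < \<delta> \<longrightarrow> succ \<gamma> < \<delta>" using succ_le_iff by (metis le_less)
    then have "\<Union>R \<inter> {\<gamma><..<\<beta>} \<subseteq> \<Union>R \<inter> {succ \<gamma><..<\<beta>}" by auto
    then have subset: "?E (succ \<gamma>) (t(\<gamma> \<mapsto> i)) \<subseteq> ?E \<gamma> t" for i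
      using map_le_trans[OF t_le] index_ge_on_mono by blast
    have "t(\<gamma> \<mapsto> True) \<in> nodes P \<beta>" unfolding nodes_def using split_node \<gamma> less.prems by blast
    then obtain u where u: "u \<in> ?E (succ \<gamma>) (t(\<gamma> \<mapsto> True))"
      using admissible_level_extend[OF admissible[OF \<beta>(1)] _ R] ht_node[OF \<gamma>(2) split_node] \<gamma> less.prems
      by (metis (no_types, lifting) mem_Collect_eq)
    have "t(\<gamma> \<mapsto> True) \<subseteq>\<^sub>m u" using u by blast
    then have "u \<gamma> = Some True" by (rule map_le_SomeD) simp
    then have "\<not> t(\<gamma> \<mapsto> False) \<subseteq>\<^sub>m u" using map_le_SomeD[of "t(\<gamma> \<mapsto> False)" u \<gamma>] by auto
    then have "u \<notin> ?E (succ \<gamma>) (t(\<gamma> \<mapsto> False))" by blast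
    then have "?E (succ \<gamma>) (t(\<gamma> \<mapsto> False)) \<subset> ?E \<gamma> t" using subset u by blast
    then have "card (?E (succ \<gamma>) (t(\<gamma> \<mapsto> False))) < card (?E \<gamma> t)" by (rule psubset_card_mono[OF fin])
    then have "infinite (?E (succ \<gamma>) (t(\<gamma> \<mapsto> False)))"
      using less.hyps split_node[OF \<gamma>(2) less.prems(1)] \<gamma>(3) by blast
    then show False using finite_subset[OF subset fin] by blast
  qed
qed

lemma index_finite_to_one_on_node:
  assumes d: "good X d" and t: "\<gamma> \<in> I" "t \<in> P \<gamma>"
  shows "index_finite_to_one_on P (d \<inter> {..\<gamma>}) t"
proof (cases "d \<inter> {..\<gamma>} = {}")
  case True
  then show ?thesis by (simp add: index_finite_to_one_on_def)
next
  case False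
  then obtain \<eta> where \<eta>: "\<eta> \<in> d" "\<eta> \<le> \<gamma>" by auto
  define \<delta> where "\<delta> = last_le d \<gamma>"
  note closed = good_imp_order_closed[OF d]
  have \<delta>: "\<delta> \<in> d" "\<delta> \<le> \<gamma>"
    unfolding \<delta>_def using last_le_mem[OF closed \<eta>] last_le_le[OF closed \<eta>] by simp_all
  let ?t = "t |` {..<\<delta>}"
  have "\<delta> \<in> I" "?t \<in> P \<delta>" using restrict_node initial_segment t \<delta>(2) by blast+
  then have "index_finite_to_one_on P (d \<inter> {..\<delta>} \<inter> {..<\<delta>}) ?t"
    using admissible_branch_index admissible_node good_Int_atMost[OF d \<delta>(1)] by blast
  then have fin: "finite {\<eta> \<in> d \<inter> {..\<delta>} \<inter> {..<\<delta>}. index P ?t \<eta> < N}" for N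
    by (simp add: index_finite_to_one_on_def)
  have subset: "{\<eta> \<in> d \<inter> {..\<gamma>}. index P t \<eta> < N} \<subseteq>
    insert \<delta> {\<eta> \<in> d \<inter> {..\<delta>} \<inter> {..<\<delta>}. index P ?t \<eta> < N}" for N
  proof
    fix \<eta> assume \<eta>: "\<eta> \<in> {\<eta> \<in> d \<inter> {..\<gamma>}. index P t \<eta> < N}"
    then have "\<eta> \<le> \<delta>" unfolding \<delta>_def using le_last_le[OF closed] by blast
    moreover have "index P t \<eta> = index P ?t \<eta>" if "\<eta> < \<delta>"
      using that \<delta>(2) dom_node[OF t] by (intro index_map_le restrict_map_le) auto
    ultimately show "\<eta> \<in> insert \<delta> {\<eta> \<in> d \<inter> {..\<delta>} \<inter> {..<\<delta>}. index P ?t \<eta> < N}"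
      using \<eta> by (cases "\<eta> = \<delta>") auto
  qed
  show ?thesis
    unfolding index_finite_to_one_on_def
    by (intro allI finite_subset[OF subset] finite.insertI fin)
qed

lemma extend_node_large_index_at_max:
  assumes \<beta>: "\<beta> \<in> I" "\<gamma> < \<beta>" "u \<in> P \<gamma>" and D: "finite D" "\<forall>d\<in>D. good X d \<and> \<beta> \<in> d"
  shows "\<exists>t\<in>P \<beta>. u \<subseteq>\<^sub>m t \<and> index_ge_on P N (\<Union>D \<inter> {\<gamma><..\<beta>}) t"
proof (cases "D = {}")
  case True
  then show ?thesis using extend_node[OF \<beta>(1) less_imp_le[OF \<beta>(2)] \<beta>(3)]
    by (metis Int_empty_left Union_empty empty_iff index_ge_on_def)
next
  case False
  define R where "R = (\<lambda>d. d \<inter> {..\<beta>}) ` D"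
  let ?E = "{t \<in> P \<beta>. u \<subseteq>\<^sub>m t \<and> index_ge_on P N (\<Union>R \<inter> {\<gamma><..<\<beta>}) t}"
  have "limit_ord \<beta>" using False D(2) good_imp_limit_ord by blast
  moreover have "R \<in> Fpow (good_with_max X \<beta>)"
    using D good_Int_atMost unfolding R_def Fpow_def by auto
  ultimately have "infinite ?E" using infinite_large_extensions \<beta> by blast
  moreover have "inj_on (to_nat_on (P \<beta>)) ?E"
    using inj_on_to_nat_on[OF countable_level[OF \<beta>(1)]] by (rule inj_on_subset) blast
  ultimately have "infinite (to_nat_on (P \<beta>) ` ?E)" using finite_imageD by blast
  then obtain t where t: "t \<in> ?E" "N \<le> to_nat_on (P \<beta>) t"
    unfolding infinite_nat_iff_unbounded_le by blast
  have "t |` {..<\<beta>} = t" using restrict_dom_map_le[of t t] dom_node[of \<beta> t] \<beta>(1) t(1) by simp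
  then have "index_ge_on P N {\<beta>} t" using t(2) by (simp add: index_ge_on_def index_def)
  moreover have "index_ge_on P N (\<Union>R \<inter> {\<gamma><..<\<beta>}) t" using t(1) by simp
  ultimately have "index_ge_on P N (\<Union>R \<inter> {\<gamma><..<\<beta>} \<union> {\<beta>}) t" unfolding index_ge_on_Un by blast
  then have "index_ge_on P N (\<Union>D \<inter> {\<gamma><..\<beta>}) t"
    by (rule index_ge_on_mono) (auto simp: R_def le_less)
  then show ?thesis using t(1) by blast
qed

text \<open>The sets in \<open>D\<close> not containing \<open>\<beta>\<close> are bounded below \<open>\<beta>\<close> and are dealt with by induction.\<close>

lemma extend_node_large_index:
  assumes "\<beta> \<in> I" "\<alpha> \<le> \<beta>" "t \<in> P \<alpha>" and D: "finite D" "\<forall>d\<in>D. good X d"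
  shows "\<exists>t'\<in>P \<beta>. t \<subseteq>\<^sub>m t' \<and> index_ge_on P N (\<Union>D \<inter> {\<alpha><..\<beta>}) t'"
  using assms(1,2)
proof (induction \<beta> rule: less_induct)
  case (less \<beta>)
  show ?case
  proof (cases "\<alpha> = \<beta>")
    case True
    then show ?thesis using assms(3) by (intro bexI[of _ t]) (auto simp: index_ge_on_def)
  next
    case False
    then have "\<alpha> < \<beta>" using less.prems by simp
    let ?D\<^sub>0 = "{d \<in> D. \<beta> \<notin> d}" and ?D\<^sub>1 = "{d \<in> D. \<beta> \<in> d}"
    have "order_closed (\<Union>?D\<^sub>0)"
      using D good_imp_order_closed by (intro order_closed_Union) auto
    moreover have "\<beta> \<notin> \<Union>?D\<^sub>0" by blast
    ultimately obtain \<gamma> where \<gamma>: "\<alpha> \<le> \<gamma>" "\<gamma> < \<beta>" "\<Union>?D\<^sub>0 \<inter> {\<gamma><..<\<beta>} = {}"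
      using \<open>\<alpha> < \<beta>\<close> order_closed_gap by blast
    have "\<gamma> \<in> I" using less.prems(1) \<gamma>(2) initial_segment by (meson less_imp_le)
    then obtain u where u: "u \<in> P \<gamma>" "t \<subseteq>\<^sub>m u" "index_ge_on P N (\<Union>D \<inter> {\<alpha><..\<gamma>}) u"
      using less.IH[OF \<gamma>(2) _ \<gamma>(1)] by blast
    obtain t' where t': "t' \<in> P \<beta>" "u \<subseteq>\<^sub>m t'" "index_ge_on P N (\<Union>?D\<^sub>1 \<inter> {\<gamma><..\<beta>}) t'"
      using extend_node_large_index_at_max[OF less.prems(1) \<gamma>(2) u(1), of ?D\<^sub>1 N] D by fastforce
    have "index_ge_on P N (\<Union>D \<inter> {\<alpha><..\<gamma>}) t'"
      using u(3) index_ge_on_map_le[OF t'(2), of "\<Union>D \<inter> {\<alpha><..\<gamma>}"] dom_node[OF \<open>\<gamma> \<in> I\<close> u(1)] by auto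
    then have "index_ge_on P N (\<Union>D \<inter> {\<alpha><..\<gamma>} \<union> \<Union>?D\<^sub>1 \<inter> {\<gamma><..\<beta>}) t'"
      using t'(3) by (simp add: index_ge_on_Un)
    moreover have "\<beta> \<in> d" if "d \<in> D" "\<delta> \<in> d" "\<gamma> < \<delta>" "\<delta> \<le> \<beta>" for d \<delta>
      using \<gamma>(3) that by (cases "\<delta> = \<beta>") auto
    then have "\<Union>D \<inter> {\<alpha><..\<beta>} \<subseteq> \<Union>D \<inter> {\<alpha><..\<gamma>} \<union> \<Union>?D\<^sub>1 \<inter> {\<gamma><..\<beta>}" by (auto simp: not_le)
    ultimately show ?thesis
      using index_ge_on_mono t'(1) map_le_trans[OF u(2) t'(2)] by blast
  qed
qed

end

section \<open>Construction of limit levels\<close>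

lemma mono_crossing:
  fixes g :: "nat \<Rightarrow> 'a :: linorder"
  assumes "mono g" "g m < \<delta>" "\<delta> \<le> g k"
  obtains i where "m \<le> i" "g i < \<delta>" "\<delta> \<le> g (Suc i)"
proof -
  have "\<exists>i\<ge>m. g i < \<delta> \<and> \<delta> \<le> g (Suc i)"
    using assms(3)
  proof (induction k)
    case 0
    then show ?case using assms(1,2) monoD[of g 0 m] by simp
  next
    case (Suc k)
    then show ?case
    proof (cases "\<delta> \<le> g k")
      case False
      have "m \<le> k"
        using Suc.prems assms(1,2) monoD[of g "Suc k" m] by (metis leD not_less_eq_eq order_trans)
      then show ?thesis using False Suc.prems by auto
    qed (rule Suc.IH)
  qed
  then show ?thesis using that by blast
qed

locale limit_stage = partial_tree \<A> \<S> X P "{..<\<kappa>}" for \<A> \<S> X P \<kappa> +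
  assumes limit: "limit_ord \<kappa>"
begin

lemma node_ht: "t \<in> nodes P \<kappa> \<Longrightarrow> t \<in> P (ht t) \<and> ht t < \<kappa>"
  unfolding nodes_def using ht_node by auto

lemma nodeI: "t \<in> P \<gamma> \<Longrightarrow> \<gamma> < \<kappa> \<Longrightarrow> t \<in> nodes P \<kappa>"
  unfolding nodes_def by blast

lemma dom_node_ht: "t \<in> nodes P \<kappa> \<Longrightarrow> dom t = {..<ht t}"
  using dom_node node_ht by simp

lemma ht_mono: "s \<in> nodes P \<kappa> \<Longrightarrow> t \<in> nodes P \<kappa> \<Longrightarrow> s \<subseteq>\<^sub>m t \<Longrightarrow> ht s \<le> ht t"
  using map_le_implies_dom_le dom_node_ht by fastforce

lemma extend_above:
  assumes "t \<in> nodes P \<kappa>" "\<epsilon> < \<kappa>"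
  obtains t' where "t' \<in> nodes P \<kappa>" "t \<subseteq>\<^sub>m t'" "\<epsilon> < ht t'"
proof -
  let ?\<gamma> = "succ (max (ht t) \<epsilon>)"
  have "?\<gamma> < \<kappa>" using limit assms node_ht unfolding limit_ord_def by simp
  moreover have "ht t \<le> ?\<gamma>" "\<epsilon> < ?\<gamma>" by (simp_all add: less_succ_iff less_imp_le)
  ultimately show ?thesis using extend_node[of ?\<gamma> "ht t" t] that node_ht assms nodeI ht_node
    by (metis lessThan_iff)
qed

lemma cofinal_branch_through_chain:
  assumes t: "\<And>n. t n \<in> nodes P \<kappa>" "\<And>n. t n \<subseteq>\<^sub>m t (Suc n)"
    and cofinal: "\<And>\<beta>. \<beta> < \<kappa> \<Longrightarrow> \<exists>n. \<beta> < ht (t n)"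
  obtains b where "cofinal_branch P \<kappa> b" "\<And>n. t n \<subseteq>\<^sub>m b"
proof -
  obtain b where b: "dom b = (\<Union>n. dom (t n))" "\<And>n. t n \<subseteq>\<^sub>m b"
    using map_chain_upper_bound[of t, OF t(2)] by metis
  have "dom b = {..<\<kappa>}"
    using b(1) dom_node_ht t(1) node_ht cofinal by (auto intro: less_trans)
  moreover have "b |` {..<\<beta>} \<in> P \<beta>" if "\<beta> < \<kappa>" for \<beta>
  proof -
    obtain n where n: "\<beta> < ht (t n)" using cofinal \<open>\<beta> < \<kappa>\<close> by blast
    then have "b |` {..<\<beta>} = t n |` {..<\<beta>}"
      using restrict_map_le_agree[OF b(2)] dom_node_ht[OF t(1)] by auto
    then show ?thesis using restrict_node[of "ht (t n)" "t n" \<beta>] node_ht[OF t(1)] n by simp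
  qed
  ultimately have "cofinal_branch P \<kappa> b" by (simp add: cofinal_branch_def)
  then show ?thesis using that b(2) by blast
qed

lemma cofinal_branch_through_steps:
  assumes t\<^sub>0: "t\<^sub>0 \<in> nodes P \<kappa>"
    and step: "\<And>n t \<epsilon>. t \<in> nodes P \<kappa> \<Longrightarrow> \<epsilon> < \<kappa> \<Longrightarrow>
      \<exists>t'. t' \<in> nodes P \<kappa> \<and> t \<subseteq>\<^sub>m t' \<and> \<epsilon> < ht t' \<and> Q n t t'"
  obtains b t where "cofinal_branch P \<kappa> b" "t 0 = t\<^sub>0" "\<And>n. t n \<in> nodes P \<kappa>" "\<And>n. t n \<subseteq>\<^sub>m t (Suc n)"
    "\<And>n. t n \<subseteq>\<^sub>m b" "\<And>n. Q n (t n) (t (Suc n))" "\<And>\<beta>. \<beta> < \<kappa> \<Longrightarrow> \<exists>n. \<beta> < ht (t n)"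
proof -
  have "{..<\<kappa>} \<noteq> {}" using limit by (simp add: limit_ord_def)
  then obtain e :: "nat \<Rightarrow> omega1" where e: "range e = {..<\<kappa>}"
    using range_from_nat_into[OF _ countable_lessThan_omega1] by blast
  then have "e n < \<kappa>" for n by blast
  then have "\<exists>f. \<forall>n. (f n \<in> nodes P \<kappa> \<and> (n = 0 \<longrightarrow> f n = t\<^sub>0)) \<and>
    (f n \<subseteq>\<^sub>m f (Suc n) \<and> e n < ht (f (Suc n)) \<and> Q n (f n) (f (Suc n)))"
    using t\<^sub>0 step by (intro dependent_nat_choice) auto
  then obtain t where t: "\<And>n. t n \<in> nodes P \<kappa>" "t 0 = t\<^sub>0" "\<And>n. t n \<subseteq>\<^sub>m t (Suc n)"
    "\<And>n. e n < ht (t (Suc n))" "\<And>n. Q n (t n) (t (Suc n))" by metis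
  have cofinal: "\<exists>n. \<beta> < ht (t n)" if "\<beta> < \<kappa>" for \<beta>
    using that e t(4) by (metis lessThan_iff rangeE)
  obtain b where "cofinal_branch P \<kappa> b" "\<And>n. t n \<subseteq>\<^sub>m b"
    using cofinal_branch_through_chain[of t, OF t(1,3) cofinal] by metis
  then show ?thesis using that t cofinal by blast
qed

lemma deciding_extension:
  assumes t: "t \<in> nodes P \<kappa>" and A: "A \<subseteq> nodes P \<kappa>" and "\<epsilon> < \<kappa>"
  obtains t' where "t' \<in> nodes P \<kappa>" "t \<subseteq>\<^sub>m t'" "\<epsilon> < ht t'" "decides A t'"
proof -
  obtain u where "u \<in> nodes P \<kappa>" "t \<subseteq>\<^sub>m u" "decides A u"
  proof (cases "\<exists>s\<in>A. t \<subseteq>\<^sub>m s")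
    case True
    then obtain s where "s \<in> A" "t \<subseteq>\<^sub>m s" by blast
    moreover from \<open>s \<in> A\<close> have "decides A s" unfolding decides_def by (blast intro: map_le_refl)
    ultimately show ?thesis using that A by blast
  next
    case False
    then have "decides A t" unfolding decides_def by blast
    then show ?thesis using that t by simp
  qed
  moreover obtain t' where "t' \<in> nodes P \<kappa>" "u \<subseteq>\<^sub>m t'" "\<epsilon> < ht t'"
    using extend_above \<open>u \<in> nodes P \<kappa>\<close> \<open>\<epsilon> < \<kappa>\<close> .
  ultimately show ?thesis using that map_le_trans decides_map_le by metis
qed

lemma sealing_branch:
  assumes t\<^sub>0: "t\<^sub>0 \<in> nodes P \<kappa>"
  obtains b where "cofinal_branch P \<kappa> b" "t\<^sub>0 \<subseteq>\<^sub>m b"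
    "\<forall>S\<in>\<S> \<kappa>. \<exists>\<beta><\<kappa>. decides (S \<inter> nodes P \<kappa>) (b |` {..<\<beta>})"
proof -
  let ?S = "\<lambda>n. from_nat_into (\<S> \<kappa>) n \<inter> nodes P \<kappa>"
  have "\<exists>t'. t' \<in> nodes P \<kappa> \<and> t \<subseteq>\<^sub>m t' \<and> \<epsilon> < ht t' \<and> decides (?S n) t'"
    if "t \<in> nodes P \<kappa>" "\<epsilon> < \<kappa>" for n t \<epsilon>
    using deciding_extension[OF that(1) Int_lower2 that(2)] by metis
  from cofinal_branch_through_steps[where Q = "\<lambda>n _. decides (?S n)", OF t\<^sub>0 this]
  obtain b t where b: "cofinal_branch P \<kappa> b" "t 0 = t\<^sub>0" "\<And>n. t n \<in> nodes P \<kappa>" "\<And>n. t n \<subseteq>\<^sub>m b"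
    "\<And>n. decides (?S n) (t (Suc n))" by metis
  have "\<exists>\<beta><\<kappa>. decides (S \<inter> nodes P \<kappa>) (b |` {..<\<beta>})" if S: "S \<in> \<S> \<kappa>" for S
  proof -
    obtain n where "from_nat_into (\<S> \<kappa>) n = S" using from_nat_into_surj[OF countable_\<S> S] by blast
    moreover have "b |` {..<ht (t (Suc n))} = t (Suc n)"
      using restrict_dom_map_le[OF b(4)] dom_node_ht[OF b(3)] by metis
    ultimately show ?thesis using b(5)[of n] node_ht[OF b(3), of "Suc n"] by metis
  qed
  then show ?thesis using that b(1) b(2) b(4)[of 0] by metis
qed

lemma extend_above_large_index:
  assumes t: "t \<in> nodes P \<kappa>" and "\<epsilon> < \<kappa>" and D: "finite D" "\<forall>d\<in>D. good X d"
  shows "\<exists>t'. t' \<in> nodes P \<kappa> \<and> t \<subseteq>\<^sub>m t' \<and> \<epsilon> < ht t' \<and> index_ge_on P N (\<Union>D \<inter> {ht t<..ht t'}) t'"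
proof -
  obtain u where u: "u \<in> nodes P \<kappa>" "t \<subseteq>\<^sub>m u" "\<epsilon> < ht u" using extend_above[OF t \<open>\<epsilon> < \<kappa>\<close>] .
  then obtain t' where "t' \<in> P (ht u)" "t \<subseteq>\<^sub>m t'" "index_ge_on P N (\<Union>D \<inter> {ht t<..ht u}) t'"
    using extend_node_large_index[of "ht u" "ht t" t D N] D node_ht t ht_mono by auto
  moreover have "ht t' = ht u" using ht_node \<open>t' \<in> P (ht u)\<close> node_ht[OF u(1)] by simp
  ultimately show ?thesis using u node_ht nodeI by metis
qed

lemma branch_with_growing_index:
  assumes t\<^sub>0: "t\<^sub>0 \<in> nodes P \<kappa>"
    and D: "\<And>n. finite (D n)" "\<And>n. \<forall>d\<in>D n. good X d" "\<And>m n. m \<le> n \<Longrightarrow> D m \<subseteq> D n"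
  obtains b t where "cofinal_branch P \<kappa> b" "t 0 = t\<^sub>0" "\<And>n. t n \<in> nodes P \<kappa>" "\<And>n. t n \<subseteq>\<^sub>m b"
    "\<And>n. index_ge_on P (N + n) (\<Union>(D n) \<inter> {ht (t n)<..<\<kappa>}) b"
proof -
  let ?Q = "\<lambda>n t t'. index_ge_on P (N + n) (\<Union>(D n) \<inter> {ht t<..ht t'}) t'"
  have "\<exists>t'. t' \<in> nodes P \<kappa> \<and> t \<subseteq>\<^sub>m t' \<and> \<epsilon> < ht t' \<and> ?Q n t t'"
    if "t \<in> nodes P \<kappa>" "\<epsilon> < \<kappa>" for n t \<epsilon>
    using that D(1,2) by (rule extend_above_large_index)
  from cofinal_branch_through_steps[where Q = ?Q, OF t\<^sub>0 this]
  obtain b t where b: "cofinal_branch P \<kappa> b" "t 0 = t\<^sub>0" "\<And>n. t n \<in> nodes P \<kappa>" "\<And>n. t n \<subseteq>\<^sub>m t (Suc n)"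
    "\<And>n. t n \<subseteq>\<^sub>m b" "\<And>n. ?Q n (t n) (t (Suc n))" "\<And>\<beta>. \<beta> < \<kappa> \<Longrightarrow> \<exists>n. \<beta> < ht (t n)" by blast
  have mono: "mono (\<lambda>n. ht (t n))" using ht_mono b(3,4) by (intro mono_iff_le_Suc[THEN iffD2]) blast
  have "index_ge_on P (N + n) (\<Union>(D n) \<inter> {ht (t n)<..<\<kappa>}) b" for n
    unfolding index_ge_on_def
  proof
    fix \<delta> assume \<delta>: "\<delta> \<in> \<Union>(D n) \<inter> {ht (t n)<..<\<kappa>}"
    then obtain k where "\<delta> \<le> ht (t k)" using b(7)[of \<delta>] by (auto intro: less_imp_le)
    then obtain i where i: "n \<le> i" "ht (t i) < \<delta>" "\<delta> \<le> ht (t (Suc i))"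
      using mono_crossing[OF mono, of n \<delta> k] \<delta> by auto
    have "index P b \<delta> = index P (t (Suc i)) \<delta>"
      using i(3) dom_node_ht[OF b(3)] by (intro index_map_le b(5)) auto
    moreover have "\<delta> \<in> \<Union>(D i) \<inter> {ht (t i)<..ht (t (Suc i))}" using D(3)[OF i(1)] \<delta> i by auto
    ultimately have "N + i \<le> index P b \<delta>" using b(6)[of i] unfolding index_ge_on_def by simp
    then show "N + n \<le> index P b \<delta>" using i(1) by simp
  qed
  then show ?thesis using that b(1-3,5) by blast
qed

lemma finite_small_index_if_large_above_node:
  assumes d: "good X d" and t: "t \<in> nodes P \<kappa>" "t \<subseteq>\<^sub>m b"
    and large: "index_ge_on P N (d \<inter> {ht t<..<\<kappa>}) b"
  shows "finite {\<delta> \<in> d \<inter> {..<\<kappa>}. index P b \<delta> < N}"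
proof -
  have "index_finite_to_one_on P (d \<inter> {..ht t}) t"
    using index_finite_to_one_on_node[OF d] node_ht[OF t(1)] by simp
  then have "finite {\<delta> \<in> d \<inter> {..ht t}. index P t \<delta> < N}" by (simp add: index_finite_to_one_on_def)
  moreover have "{\<delta> \<in> d \<inter> {..<\<kappa>}. index P b \<delta> < N} \<subseteq> {\<delta> \<in> d \<inter> {..ht t}. index P t \<delta> < N}"
  proof
    fix \<delta> assume \<delta>: "\<delta> \<in> {\<delta> \<in> d \<inter> {..<\<kappa>}. index P b \<delta> < N}"
    then have "\<delta> \<le> ht t" using large by (force simp: index_ge_on_def)
    moreover from this have "index P b \<delta> = index P t \<delta>"
      using dom_node_ht[OF t(1)] by (intro index_map_le t(2)) auto
    ultimately show "\<delta> \<in> {\<delta> \<in> d \<inter> {..ht t}. index P t \<delta> < N}" using \<delta> by simp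
  qed
  ultimately show ?thesis by (rule rev_finite_subset)
qed

text \<open>From the \<open>n\<close>-th step on, the indices are at least \<open>N + n\<close> along the sets in \<open>R\<close> and along the
  first \<open>n\<close> good sets with maximum \<open>\<kappa>\<close>.\<close>

lemma specializing_branch:
  assumes t\<^sub>0: "t\<^sub>0 \<in> nodes P \<kappa>" and R: "R \<in> Fpow (good_with_max X \<kappa>)"
  obtains b where "cofinal_branch P \<kappa> b" "t\<^sub>0 \<subseteq>\<^sub>m b" "index_ge_on P N (\<Union>R \<inter> {ht t\<^sub>0<..<\<kappa>}) b"
    "\<forall>d\<in>good_with_max X \<kappa>. index_finite_to_one_on P (d \<inter> {..<\<kappa>}) b"
proof -
  let ?G = "good_with_max X \<kappa>"
  define D where "D n = R \<union> (from_nat_into ?G ` {..n} \<inter> ?G)" for n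
  have "finite (D n)" "\<forall>d\<in>D n. good X d" for n
    using R by (auto simp: D_def Fpow_def good_with_max_def)
  moreover have "D m \<subseteq> D n" if "m \<le> n" for m n using that by (auto simp: D_def)
  ultimately obtain b t where b: "cofinal_branch P \<kappa> b" "t 0 = t\<^sub>0" "\<And>n. t n \<in> nodes P \<kappa>" "\<And>n. t n \<subseteq>\<^sub>m b"
    "\<And>n. index_ge_on P (N + n) (\<Union>(D n) \<inter> {ht (t n)<..<\<kappa>}) b"
    using branch_with_growing_index[OF t\<^sub>0] by metis
  have "finite {\<delta> \<in> d \<inter> {..<\<kappa>}. index P b \<delta> < M}" if d: "d \<in> ?G" for d M
  proof -
    obtain k where "from_nat_into ?G k = d"
      using from_nat_into_surj[OF countable_good_with_max d] by blast
    then have "d \<in> D (max k M)" using d unfolding D_def by (auto intro!: image_eqI[of d _ k])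
    then have "index_ge_on P M (d \<inter> {ht (t (max k M))<..<\<kappa>}) b"
      by (intro index_ge_on_mono[OF b(5)[of "max k M"]]) auto
    moreover have "good X d" using d by (simp add: good_with_max_def)
    ultimately show ?thesis using finite_small_index_if_large_above_node b(3,4) by blast
  qed
  then have "\<forall>d\<in>?G. index_finite_to_one_on P (d \<inter> {..<\<kappa>}) b" by (simp add: index_finite_to_one_on_def)
  moreover have "index_ge_on P N (\<Union>R \<inter> {ht t\<^sub>0<..<\<kappa>}) b"
    using b(5)[of 0] by (rule index_ge_on_mono) (auto simp: D_def b(2))
  moreover have "t\<^sub>0 \<subseteq>\<^sub>m b" using b(2) b(4)[of 0] by simp
  ultimately show ?thesis using that b(1) by blast
qed

lemma admissible_branch_exists:
  assumes "t \<in> nodes P \<kappa>" "R \<in> Fpow (good_with_max X \<kappa>)"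
  shows "\<exists>b. admissible_branch X \<kappa> P b \<and> t \<subseteq>\<^sub>m b \<and> index_ge_on P N (\<Union>R \<inter> {ht t<..<\<kappa>}) b"
proof (cases "\<kappa> \<in> X")
  case True
  then have no_good: "good_with_max X \<kappa> = {}" by (simp add: good_with_max_empty)
  then have "R = {}" using assms(2) by (simp add: Fpow_def)
  then show ?thesis
    using sealing_branch[OF assms(1)] no_good
    unfolding admissible_branch_def index_ge_on_def by (metis Int_empty_left Union_empty empty_iff)
next
  case False
  then show ?thesis
    using specializing_branch[OF assms, of N] unfolding admissible_branch_def by metis
qed

lemma admissible_limit_level_exists: "\<exists>L. admissible_level X \<kappa> P L"
proof -
  define J where "J = nodes P \<kappa> \<times> Fpow (good_with_max X \<kappa>) \<times> (UNIV :: nat set)"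
  have "\<forall>j\<in>J. \<exists>b. case j of (t, R, N) \<Rightarrow>
    admissible_branch X \<kappa> P b \<and> t \<subseteq>\<^sub>m b \<and> index_ge_on P N (\<Union>R \<inter> {ht t<..<\<kappa>}) b"
    using admissible_branch_exists unfolding J_def by auto
  from bchoice[OF this] obtain b where b: "\<forall>j\<in>J. case j of (t, R, N) \<Rightarrow>
    admissible_branch X \<kappa> P (b j) \<and> t \<subseteq>\<^sub>m b j \<and> index_ge_on P N (\<Union>R \<inter> {ht t<..<\<kappa>}) (b j)" ..
  have "countable J"
    unfolding J_def using countable_nodes countable_Fpow[OF countable_good_with_max] by simp
  then have "countable (b ` J)" by simp
  moreover have "b ` J \<noteq> {}"
  proof -
    obtain \<gamma> where "\<gamma> < \<kappa>" using limit unfolding limit_ord_def by blast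
    then obtain t where "t \<in> nodes P \<kappa>" using level_nonempty nodeI by blast
    then have "(t, {}, 0) \<in> J" by (simp add: J_def Fpow_def)
    then show ?thesis by blast
  qed
  moreover have "\<forall>c\<in>b ` J. admissible_branch X \<kappa> P c" using b by auto
  moreover have "\<kappa> \<noteq> succ \<beta>" for \<beta> using limit not_limit_ord_succ by blast
  moreover have "\<exists>c\<in>b ` J. t \<subseteq>\<^sub>m c \<and> index_ge_on P N (\<Union>R \<inter> {ht t<..<\<kappa>}) c"
    if "t \<in> nodes P \<kappa>" "R \<in> Fpow (good_with_max X \<kappa>)" for t R N
    using b that by (intro bexI[of _ "b (t, R, N)"]) (auto simp: J_def)
  ultimately have "admissible_level X \<kappa> P (b ` J)" unfolding admissible_level_def by blast
  then show ?thesis by blast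
qed

end

section \<open>Construction of zero and successor levels\<close>

lemma (in guessing) admissible_zero_level:
  assumes "{..<\<kappa>} = {}"
  shows "admissible_level X \<kappa> P {Map.empty}"
proof -
  have no_less: "\<not> \<beta> < \<kappa>" for \<beta> using assms by auto
  then have "\<kappa> \<noteq> succ \<beta>" for \<beta> using less_succ by blast
  moreover have "\<not> limit_ord \<kappa>" using assms by (simp add: limit_ord_def)
  ultimately show ?thesis
    unfolding admissible_level_def admissible_branch_def
    using assms no_less by (simp add: good_with_max_empty nodes_def cofinal_branch_def)
qed

lemma (in partial_tree) admissible_succ_level:
  assumes \<beta>: "\<beta> \<in> I"
  shows "admissible_level X (succ \<beta>) P {t(\<beta> \<mapsto> i) | t i. t \<in> P \<beta>}" (is "admissible_level _ _ _ ?L")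
proof -
  note no_good = good_with_max_empty[OF disjI2[OF not_limit_ord_succ]]
  have t_le: "t \<subseteq>\<^sub>m t(\<beta> \<mapsto> i)" if "t \<in> P \<beta>" for t i
    using dom_node[OF \<beta> that] by (intro map_le_fun_upd) simp
  have "?L = (\<lambda>(t, i). t(\<beta> \<mapsto> i)) ` (P \<beta> \<times> UNIV)" by auto
  then have "countable ?L" using countable_level[OF \<beta>] by simp
  moreover have "?L \<noteq> {}" using level_nonempty[OF \<beta>] by blast
  moreover have "admissible_branch X (succ \<beta>) P b" if "b \<in> ?L" for b
  proof -
    from that obtain t i where t: "t \<in> P \<beta>" "b = t(\<beta> \<mapsto> i)" by blast
    have "b |` {..<\<gamma>} \<in> P \<gamma>" if "\<gamma> \<le> \<beta>" for \<gamma>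
    proof -
      have "b |` {..<\<gamma>} = t |` {..<\<gamma>}"
        unfolding t(2) using t_le[OF t(1)] dom_node[OF \<beta> t(1)] that by (intro restrict_map_le_agree) auto
      then show ?thesis using restrict_node[OF \<beta> t(1) that] by simp
    qed
    moreover have "dom b = {..<succ \<beta>}" using t dom_node[OF \<beta> t(1)] by (simp add: lessThan_succ)
    ultimately show ?thesis
      unfolding admissible_branch_def cofinal_branch_def
      by (simp add: no_good not_limit_ord_succ less_succ_iff)
  qed
  moreover have "\<forall>\<gamma>. succ \<beta> = succ \<gamma> \<longrightarrow> (\<forall>t\<in>P \<gamma>. \<forall>i. t(\<gamma> \<mapsto> i) \<in> ?L)"
    using less_succ_iff by (metis (mono_tags, lifting) antisym less_succ mem_Collect_eq)
  moreover have "\<exists>b\<in>?L. t \<subseteq>\<^sub>m b" if t: "t \<in> nodes P (succ \<beta>)" for t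
  proof -
    obtain \<gamma> where "\<gamma> \<le> \<beta>" "t \<in> P \<gamma>" using t unfolding nodes_def by (auto simp: less_succ_iff)
    then obtain u where "u \<in> P \<beta>" "t \<subseteq>\<^sub>m u" using extend_node[OF \<beta>] by blast
    then show ?thesis using t_le[of u True] map_le_trans by blast
  qed
  ultimately show ?thesis
    unfolding admissible_level_def by (simp add: no_good Fpow_def index_ge_on_def)
qed

lemma (in guessing) admissible_level_exists:
  assumes "partial_tree \<A> \<S> X P {..<\<kappa>}"
  shows "\<exists>L. admissible_level X \<kappa> P L"
proof (cases \<kappa> rule: omega1_cases)
  case zero
  then show ?thesis using admissible_zero_level by blast
next
  case (succ \<beta>)
  then show ?thesis using partial_tree.admissible_succ_level[OF assms, of \<beta>] less_succ by auto
next
  case limit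
  then interpret limit_stage \<A> \<S> X P \<kappa>
    using assms by (simp add: limit_stage_def limit_stage_axioms_def)
  show ?thesis by (rule admissible_limit_level_exists)
qed

section \<open>Completed trees\<close>

definition tree :: "(omega1 \<Rightarrow> binseq set) \<Rightarrow> binseq set"
  where "tree P = (\<Union>\<alpha>. P \<alpha>)"

locale full_tree = partial_tree \<A> \<S> X P UNIV for \<A> \<S> X P
begin

lemma tree_ht: "t \<in> tree P \<Longrightarrow> t \<in> P (ht t)"
  unfolding tree_def using ht_node by auto

lemma level_subset_binseqs: "P \<alpha> \<subseteq> binseqs"
  unfolding binseqs_def using dom_node by blast

lemma tree_subset_binseqs: "tree P \<subseteq> binseqs"
  unfolding tree_def using level_subset_binseqs by blast

lemma subtree_tree: "subtree (tree P)"
  unfolding subtree_def by (rule tree_subset_binseqs)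

lemma downward_closed_tree: "downward_closed (tree P)"
  unfolding downward_closed_def
proof (intro ballI impI)
  fix t s assume t: "t \<in> tree P" and s: "s \<in> binseqs" "s \<subseteq>\<^sub>m t"
  have "ht s \<le> ht t" using ht_le_if_map_le s t tree_subset_binseqs by blast
  then have "t |` {..<ht s} \<in> P (ht s)" using restrict_node tree_ht[OF t] by simp
  moreover have "t |` {..<ht s} = s"
    using restrict_dom_map_le[OF s(2)] dom_eq_lessThan_ht[OF s(1)] by simp
  ultimately show "s \<in> tree P" unfolding tree_def by auto
qed

lemma level_tree: "level (tree P) \<xi> = P \<xi>"
  unfolding level_eq_ht[OF subtree_tree downward_closed_tree] using tree_ht ht_node
  by (auto simp: tree_def)

lemma tree_restrict_tree: "tree_restrict (tree P) \<alpha> = nodes P \<alpha>"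
  unfolding tree_restrict_eq_levels level_tree nodes_def ..

lemma aleph1_subtree_tree: "aleph1_subtree (tree P)"
  unfolding aleph1_subtree_def level_tree using subtree_tree countable_level level_nonempty by simp

lemma splitting_tree: "splitting (tree P)"
  unfolding splitting_def
proof (intro ballI allI)
  fix t i assume "t \<in> tree P"
  then have "t(ht t \<mapsto> i) \<in> P (succ (ht t))" using split_node tree_ht by simp
  then show "t(ht t \<mapsto> i) \<in> tree P" unfolding tree_def by blast
qed

text \<open>Along a chain, the number of earlier levels in \<open>C\<close> at which a node has the same index as at the
  top strictly increases as long as that index is constant.\<close>

lemma special_aronszajn_tree_if_good_club:
  assumes C: "club C" "good X C"
  shows "special_aronszajn_tree (tree P)"
proof -
  let ?same = "\<lambda>t. {\<delta> \<in> C \<inter> {..<ht t}. index P t \<delta> = index P t (ht t)}"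
  have fin: "finite (?same t)" if "t \<in> tree P" for t
  proof -
    have "finite {\<delta> \<in> C \<inter> {..ht t}. index P t \<delta> < Suc (index P t (ht t))}"
      using index_finite_to_one_on_node[OF C(2) _ tree_ht[OF that]]
      unfolding index_finite_to_one_on_def by blast
    then show ?thesis by (rule rev_finite_subset) auto
  qed
  show ?thesis
  proof (rule special_aronszajn_tree_if_labelled_on_club)
    show "aleph1_subtree (tree P)" "downward_closed (tree P)" "club C"
      using aleph1_subtree_tree downward_closed_tree C(1) .
  next
    fix s t assume st: "s \<in> tree P" "t \<in> tree P" "ht s \<in> C" "ht t \<in> C" "s \<subseteq>\<^sub>m t" "s \<noteq> t"
    have less: "ht s < ht t" using ht_less_if_map_le st tree_subset_binseqs by blast
    have index: "index P t \<delta> = index P s \<delta>" if "\<delta> \<le> ht s" for \<delta>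
      using that tree_subset_binseqs st(1)
      by (intro index_map_le st(5)) (simp add: dom_eq_lessThan_ht subset_iff less_le_trans)
    show "(index P s (ht s), card (?same s)) \<noteq> (index P t (ht t), card (?same t))"
    proof
      assume eq: "(index P s (ht s), card (?same s)) = (index P t (ht t), card (?same t))"
      then have "insert (ht s) (?same s) \<subseteq> ?same t" using index less st(3) by auto
      then have "?same s \<subset> ?same t" by auto
      then have "card (?same s) < card (?same t)" by (rule psubset_card_mono[OF fin[OF st(2)]])
      then show False using eq by simp
    qed
  qed
qed

lemma special_aronszajn_tree_if_not_stationary:
  assumes "\<not> stationary X"
  shows "special_aronszajn_tree (tree P)"
proof -
  obtain D where D: "club D" "X \<inter> D = {}" using assms unfolding stationary_def by blast
  obtain C where "C \<subseteq> D \<inter> {\<alpha>. limit_ord \<alpha>}" "club C" "\<forall>\<alpha>\<in>C. C \<inter> {..<\<alpha>} \<in> \<A> \<alpha>"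
    using club_guess[OF club_Int[OF D(1) club_limit_ord]] by blast
  then have "good X C" using D(2) unfolding good_def club_def by blast
  then show ?thesis using special_aronszajn_tree_if_good_club \<open>club C\<close> by blast
qed

lemma club_reflecting_extensions:
  assumes "A \<subseteq> tree P"
  obtains C where "club C"
    "\<forall>\<alpha>\<in>C. \<forall>t\<in>nodes P \<alpha>. (\<exists>s\<in>A. t \<subseteq>\<^sub>m s) \<longrightarrow> (\<exists>s\<in>A \<inter> nodes P \<alpha>. t \<subseteq>\<^sub>m s)"
proof -
  define e where "e t = (SOME s. s \<in> A \<and> t \<subseteq>\<^sub>m s)" for t
  have e: "e t \<in> A \<and> t \<subseteq>\<^sub>m e t" if "\<exists>s\<in>A. t \<subseteq>\<^sub>m s" for t
    unfolding e_def using someI_ex[of "\<lambda>s. s \<in> A \<and> t \<subseteq>\<^sub>m s"] that by blast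
  have "\<exists>\<beta>. \<forall>t\<in>P \<xi>. ht (e t) < \<beta>" for \<xi>
  proof -
    have "countable ((\<lambda>t. ht (e t)) ` P \<xi>)" using countable_level by simp
    then obtain \<beta> where "\<forall>a\<in>(\<lambda>t. ht (e t)) ` P \<xi>. a < \<beta>" by (rule bounded_omega1)
    then show ?thesis by auto
  qed
  then obtain g where g: "\<And>\<xi> t. t \<in> P \<xi> \<Longrightarrow> ht (e t) < g \<xi>" by metis
  have "\<exists>s\<in>A \<inter> nodes P \<alpha>. t \<subseteq>\<^sub>m s"
    if \<alpha>: "\<alpha> \<in> closure_points g" and t: "t \<in> nodes P \<alpha>" "\<exists>s\<in>A. t \<subseteq>\<^sub>m s" for \<alpha> t
  proof -
    obtain \<xi> where "\<xi> < \<alpha>" "t \<in> P \<xi>" using t(1) unfolding nodes_def by blast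
    then have "ht (e t) < \<alpha>" using g closure_points_less[OF \<alpha>] less_trans by blast
    then have "e t \<in> nodes P \<alpha>" using e[OF t(2)] assms tree_ht unfolding nodes_def by blast
    then show ?thesis using e[OF t(2)] by blast
  qed
  then show ?thesis using that club_closure_points[of g] by blast
qed

lemma antichain_subset_nodes_if_sealed:
  assumes A: "antichain (tree P) A"
    and reflects: "\<forall>t\<in>nodes P \<alpha>. (\<exists>s\<in>A. t \<subseteq>\<^sub>m s) \<longrightarrow> (\<exists>s\<in>A \<inter> nodes P \<alpha>. t \<subseteq>\<^sub>m s)"
    and sealed: "\<forall>b\<in>P \<alpha>. \<exists>\<beta><\<alpha>. decides (A \<inter> nodes P \<alpha>) (b |` {..<\<beta>})"
  shows "A \<subseteq> nodes P \<alpha>"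
proof (rule subsetI, rule ccontr)
  fix s assume s: "s \<in> A" "s \<notin> nodes P \<alpha>"
  have "s \<in> P (ht s)" using A s(1) tree_ht unfolding antichain_def by blast
  then have le: "\<alpha> \<le> ht s" using s(2) unfolding nodes_def by (meson UN_I lessThan_iff not_le)
  then have "s |` {..<\<alpha>} \<in> P \<alpha>" using restrict_node \<open>s \<in> P (ht s)\<close> by simp
  then obtain \<beta> where \<beta>: "\<beta> < \<alpha>" "decides (A \<inter> nodes P \<alpha>) (s |` {..<\<alpha>} |` {..<\<beta>})"
    using sealed by blast
  let ?u = "s |` {..<\<beta>}"
  have "decides (A \<inter> nodes P \<alpha>) ?u" using \<beta> by (simp add: inf.absorb2)
  then consider r where "r \<in> A" "r \<in> nodes P \<alpha>" "r \<subseteq>\<^sub>m ?u" | "\<forall>r\<in>A \<inter> nodes P \<alpha>. \<not> ?u \<subseteq>\<^sub>m r"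
    unfolding decides_def by blast
  then show False
  proof cases
    case 1
    then have "r \<subseteq>\<^sub>m s" "r \<noteq> s" using map_le_trans restrict_map_le s(2) by blast+
    then show False using A s(1) \<open>r \<in> A\<close> unfolding antichain_def by blast
  next
    case 2
    have "?u \<in> P \<beta>" using restrict_node \<open>s \<in> P (ht s)\<close> \<beta>(1) le by simp
    then have "?u \<in> nodes P \<alpha>" unfolding nodes_def using \<beta>(1) by blast
    then show False using reflects s(1) restrict_map_le 2 by blast
  qed
qed

lemma countable_antichain_if_stationary:
  assumes X: "stationary X" and A: "antichain (tree P) A"
  shows "countable A"
proof -
  obtain C where C: "club C" "\<forall>\<alpha>\<in>C. \<forall>t\<in>nodes P \<alpha>. (\<exists>s\<in>A. t \<subseteq>\<^sub>m s) \<longrightarrow> (\<exists>s\<in>A \<inter> nodes P \<alpha>. t \<subseteq>\<^sub>m s)"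
    using club_reflecting_extensions[of A] A unfolding antichain_def by blast
  have "\<forall>\<xi>. countable (P \<xi>) \<and> P \<xi> \<subseteq> binseqs" using countable_level level_subset_binseqs by simp
  from node_guess[OF this, of A]
  obtain D where D: "club D" "\<forall>\<alpha>\<in>D. \<exists>S\<in>\<S> \<alpha>. S \<inter> nodes P \<alpha> = A \<inter> nodes P \<alpha>" by blast
  obtain \<alpha> where \<alpha>: "\<alpha> \<in> X" "\<alpha> \<in> C" "\<alpha> \<in> D" "limit_ord \<alpha>"
    using X club_Int[OF club_Int[OF C(1) D(1)] club_limit_ord] unfolding stationary_def by blast
  then obtain S where "S \<in> \<S> \<alpha>" "S \<inter> nodes P \<alpha> = A \<inter> nodes P \<alpha>" using D(2) by blast
  then have "\<forall>b\<in>P \<alpha>. \<exists>\<beta><\<alpha>. decides (A \<inter> nodes P \<alpha>) (b |` {..<\<beta>})"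
    using admissible_branch_decides[OF admissible_node] \<alpha> by (metis UNIV_I)
  then have "A \<subseteq> nodes P \<alpha>"
    using antichain_subset_nodes_if_sealed[OF A] C(2) \<alpha>(2) by blast
  then show ?thesis using countable_nodes countable_subset by blast
qed

lemma suslin_tree_if_stationary: "stationary X \<Longrightarrow> suslin_tree (tree P)"
  using suslin_tree_if_antichains_countable[OF aleph1_subtree_tree downward_closed_tree splitting_tree]
    countable_antichain_if_stationary by blast

end

section \<open>The recursion\<close>

context guessing
begin

definition tree_level :: "omega1 set \<Rightarrow> omega1 \<Rightarrow> binseq set"
  where "tree_level X = wfrec {(\<beta>, \<alpha>). \<beta> < \<alpha>} (\<lambda>P \<alpha>. SOME L. admissible_level X \<alpha> P L)"

lemma tree_level_unfold: "tree_level X \<alpha> = (SOME L. admissible_level X \<alpha> (tree_level X) L)"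
proof -
  let ?R = "{(\<beta>, \<alpha>). \<beta> < (\<alpha> :: omega1)}"
  have "tree_level X \<alpha> = (SOME L. admissible_level X \<alpha> (cut (tree_level X) ?R \<alpha>) L)"
    unfolding tree_level_def by (subst wfrec[OF wf]) (rule refl)
  moreover have "admissible_level X \<alpha> (cut (tree_level X) ?R \<alpha>) L \<longleftrightarrow>
      admissible_level X \<alpha> (tree_level X) L" for L
    by (rule admissible_level_cong) (simp_all add: cut_apply)
  ultimately show ?thesis by simp
qed

lemma admissible_tree_level: "admissible_level X \<alpha> (tree_level X) (tree_level X \<alpha>)"
proof (induction \<alpha> rule: less_induct)
  case (less \<alpha>)
  then have "partial_tree \<A> \<S> X (tree_level X) {..<\<alpha>}" by unfold_locales auto
  from someI_ex[OF admissible_level_exists[OF this]] show ?case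
    by (simp only: tree_level_unfold[of X \<alpha>, symmetric])
qed

lemma full_tree_tree_level: "full_tree \<A> \<S> X (tree_level X)"
  by unfold_locales (simp_all add: admissible_tree_level)

lemma tree_level_cong:
  assumes "X \<inter> {..\<alpha>} = Y \<inter> {..\<alpha>}"
  shows "tree_level X \<alpha> = tree_level Y \<alpha>"
  using assms
proof (induction \<alpha> rule: less_induct)
  case (less \<alpha>)
  have "tree_level X \<beta> = tree_level Y \<beta>" if "\<beta> < \<alpha>" for \<beta>
  proof (rule less.IH[OF that])
    have "{..\<beta>} = {..\<alpha>} \<inter> {..\<beta>}" using that by auto
    then show "X \<inter> {..\<beta>} = Y \<inter> {..\<beta>}" using less.prems by (metis Int_assoc)
  qed
  then have "admissible_level X \<alpha> (tree_level X) = admissible_level Y \<alpha> (tree_level Y)"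
    using less.prems by (intro ext admissible_level_cong)
  then show ?case unfolding tree_level_unfold[of _ \<alpha>] by simp
qed

lemma nodes_tree_level_cong:
  assumes "X \<inter> {..<\<alpha>} = Y \<inter> {..<\<alpha>}"
  shows "nodes (tree_level X) \<alpha> = nodes (tree_level Y) \<alpha>"
proof -
  have "tree_level X \<xi> = tree_level Y \<xi>" if "\<xi> < \<alpha>" for \<xi>
  proof (rule tree_level_cong)
    have "{..\<xi>} = {..<\<alpha>} \<inter> {..\<xi>}" using that by auto
    then show "X \<inter> {..\<xi>} = Y \<inter> {..\<xi>}" using assms by (metis Int_assoc)
  qed
  then show ?thesis unfolding nodes_def by simp
qed

end

theorem theorem3p3:
  assumes diamond_plus
  shows "\<exists>T :: omega1 set \<Rightarrow> binseq set.
    (\<forall>X. downward_closed (T X) \<and> aleph1_subtree (T X)) \<and>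
    (\<forall>X Y \<alpha>. X \<inter> {..<\<alpha>} = Y \<inter> {..<\<alpha>} \<longrightarrow> tree_restrict (T X) \<alpha> = tree_restrict (T Y) \<alpha>) \<and>
    (\<forall>X. stationary X \<longrightarrow> suslin_tree (T X)) \<and>
    (\<forall>X. \<not> stationary X \<longrightarrow> special_aronszajn_tree (T X))"
proof -
  obtain \<A> \<S> where "guessing \<A> \<S>" using diamond_plus_imp_guessing[OF assms] .
  then interpret guessing \<A> \<S> .
  note full = full_tree_tree_level
  show ?thesis
  proof (intro exI[of _ "\<lambda>X. tree (tree_level X)"] conjI allI impI)
    fix X Y \<alpha>
    show "downward_closed (tree (tree_level X))" using full by (rule full_tree.downward_closed_tree)
    show "aleph1_subtree (tree (tree_level X))" using full by (rule full_tree.aleph1_subtree_tree)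
    show "tree_restrict (tree (tree_level X)) \<alpha> = tree_restrict (tree (tree_level Y)) \<alpha>"
      if "X \<inter> {..<\<alpha>} = Y \<inter> {..<\<alpha>}"
      using nodes_tree_level_cong[OF that] by (simp add: full_tree.tree_restrict_tree[OF full])
    show "suslin_tree (tree (tree_level X))" if "stationary X"
      using full that by (rule full_tree.suslin_tree_if_stationary)
    show "special_aronszajn_tree (tree (tree_level X))" if "\<not> stationary X"
      using full that by (rule full_tree.special_aronszajn_tree_if_not_stationary)
  qed
qed

end
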